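(* In the mixture Cramér–Lundberg model described in the context, suppose that the stationary excess distribution $F_h^e$ of the heavy-tailed claims is subexponential. Let $n\in\mathbb{N}$, $n\ge1$, and let $$\psi_n(u) = \frac{1-\rho}{1-\rho^\bullet}\,\psi^\bullet(u) + \frac{1-\rho}{1-\rho^\bullet}\,\frac{\epsilon\theta}{1-\rho^\bullet}\,\mathbb{P}(M^\bullet_0+M^\bullet_1+C^e_1>u) + \varphi_n(u),$$ where $$\varphi_n(u)=\frac{1-\rho}{1-\rho^\bullet}\sum_{k=2}^n\left(\frac{\epsilon\theta}{1-\rho^\bullet}\right)^k\mathbb{P}\big(\max\{C^e_1,\dots,C^e_k\}>u\big).$$ Then, as $u\to\infty$, $$\psi_n(u)\sim \frac{\epsilon\theta}{1-\rho}\left(1-(n+1)\left(\frac{\epsilon\theta}{1-\rho^\bullet}\right)^n+n\left(\frac{\epsilon\theta}{1-\rho^\bullet}\right)^{n+1}\right)\overline{F_h^e}(u).$$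
   Context: Write $\overline F=1-F$ for tails; $f(u)\sim g(u)$ means $f(u)/g(u)\to1$. A distribution function $F$ on $[0,\infty)$ with $\overline F>0$ is subexponential if $\overline{F^{*n}}(u)\sim n\overline F(u)$ as $u\to\infty$ for every $n\in\mathbb{N}$ ($F^{*n}$ is the $n$-fold convolution). A phase-type distribution is the law of the absorption time of a finite-state Markov jump process with all states but one transient and the remaining one absorbing. Model. Claims arrive according to a Poisson process with rate $\lambda>0$, premium rate is $1$, and claim sizes are i.i.d., independent of the arrivals, with distribution function $G=(1-\epsilon)F_p+\epsilon F_h$, where $\epsilon\in(0,1)$, $F_p$ is the phase-type distribution function of a random variable $B$ with finite mean $\mu_B$, and $F_h$ is the subexponential distribution function of a random variable $C$ with finite mean $\mu_C$. Put $\delta=\lambda\mu_B$, $\theta=\lambda\mu_C$, $\rho^\bullet=(1-\epsilon)\delta$, $\rho=\rho^\bullet+\epsilon\theta$, and assume the net profit condition $\rho<1$. Stationary excess distributions: $F_p^e(u)=\frac1{\mu_B}\int_0^u(1-F_p(x))\,dx$ and $F_h^e(u)=\frac1{\mu_C}\int_0^u(1-F_h(x))\,dx$. Let $C^e_1,C^e_2,\dots$ be i.i.d. with distribution function $F_h^e$. Let $M^\bullet$ be the supremum of the claim surplus process of the compound Poisson risk model with premium rate $1$, arrival rate $(1-\epsilon)\lambda$ and claim size distribution $F_p$; equivalently $\mathbb{P}(M^\bullet\le u)=(1-\rho^\bullet)\sum_{k=0}^\infty(\rho^\bullet)^k(F_p^e)^{*k}(u)$. Its ruin probability is $\psi^\bullet(u)=\mathbb{P}(M^\bullet>u)$.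 Let $M^\bullet_0,M^\bullet_1,\dots$ be i.i.d. copies of $M^\bullet$, independent of $(C^e_k)_{k\ge1}$. *)

theory Defs
  imports "HOL-Probability.Probability" "HOL-Library.Landau_Symbols"
begin

section \<open>Distribution functions on the half-line\<close>

definition distribution_function_nonneg :: "(real \<Rightarrow> real) \<Rightarrow> bool" where
  "distribution_function_nonneg F \<longleftrightarrow>
     mono F \<and> (\<forall>x. continuous (at_right x) F) \<and> (\<forall>x<0. F x = 0) \<and> (F \<longlongrightarrow> 1) at_top"

primrec convolution_power :: "real measure \<Rightarrow> nat \<Rightarrow> real measure" where
  "convolution_power \<mu> 0 = return borel 0"
| "convolution_power \<mu> (Suc n) = (\<mu> \<star> convolution_power \<mu> n)"

text \<open>The law with distribution function \<open>F\<close> is the Lebesgue--Stieltjes measure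
  \<^term>\<open>interval_measure F\<close>.\<close>

definition subexponential :: "(real \<Rightarrow> real) \<Rightarrow> bool" where
  "subexponential F \<longleftrightarrow>
     distribution_function_nonneg F \<and> (\<forall>u. 1 - F u > 0) \<and>
     (\<forall>n\<ge>1. (\<lambda>u. 1 - cdf (convolution_power (interval_measure F) n) u)
               \<sim>[at_top] (\<lambda>u. real n * (1 - F u)))"

definition excess_df :: "real \<Rightarrow> (real \<Rightarrow> real) \<Rightarrow> real \<Rightarrow> real" where
  "excess_df m F u = 1 / m * (LINT x:{0..u}|lborel. 1 - F x)"


section \<open>Phase-type distributions\<close>

text \<open>A time-homogeneous Markov jump process on a finite state space is given by its path laws
  \<open>P i\<close>, one for each initial state \<open>i\<close>. Paths are right-continuous with left limits for the
  discrete topology, so there are finitely many jumps in bounded time. The last clause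
  is the Markov property in product form; it avoids conditioning on null events.\<close>

definition markov_jump_process ::
    "('s::finite \<Rightarrow> 'p measure) \<Rightarrow> (real \<Rightarrow> 'p \<Rightarrow> 's) \<Rightarrow> bool" where
  "markov_jump_process P X \<longleftrightarrow>
     (\<forall>i. prob_space (P i)) \<and>
     (\<forall>i. \<forall>t\<ge>0. X t \<in> measurable (P i) (count_space UNIV)) \<and>
     (\<forall>i. AE \<omega> in P i. X 0 \<omega> = i) \<and>
     (\<forall>i. \<forall>\<omega>\<in>space (P i). \<forall>t\<ge>0. eventually (\<lambda>s. X s \<omega> = X t \<omega>) (at_right t)) \<and>
     (\<forall>i. \<forall>\<omega>\<in>space (P i). \<forall>t>0. \<exists>j. eventually (\<lambda>s. X s \<omega> = j) (at_left t)) \<and>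
     (\<forall>i (n::nat) (t::nat \<Rightarrow> real) (x::nat \<Rightarrow> 's).
        0 \<le> t 0 \<and> (\<forall>k\<le>n. t k \<le> t (Suc k)) \<longrightarrow>
        measure (P i) {\<omega> \<in> space (P i). \<forall>k\<le>Suc n. X (t k) \<omega> = x k} =
        measure (P i) {\<omega> \<in> space (P i). \<forall>k\<le>n. X (t k) \<omega> = x k} *
        measure (P (x n)) {\<omega> \<in> space (P (x n)). X (t (Suc n) - t n) \<omega> = x (Suc n)})"

definition transient_state ::
    "('s::finite \<Rightarrow> 'p measure) \<Rightarrow> (real \<Rightarrow> 'p \<Rightarrow> 's) \<Rightarrow> 's \<Rightarrow> bool" where
  "transient_state P X i \<longleftrightarrow> (AE \<omega> in P i. bdd_above {t. 0 \<le> t \<and> X t \<omega> = i})"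

definition absorbing_state ::
    "('s::finite \<Rightarrow> 'p measure) \<Rightarrow> (real \<Rightarrow> 'p \<Rightarrow> 's) \<Rightarrow> 's \<Rightarrow> bool" where
  "absorbing_state P X i \<longleftrightarrow> (AE \<omega> in P i. \<forall>t\<ge>0. X t \<omega> = i)"

text \<open>The infimum of the empty set is \<open>\<infinity>\<close> in \<^typ>\<open>ereal\<close>.\<close>

definition absorption_time :: "(real \<Rightarrow> 'p \<Rightarrow> 's) \<Rightarrow> 's \<Rightarrow> 'p \<Rightarrow> ereal" where
  "absorption_time X a \<omega> = Inf (ereal ` {t. 0 \<le> t \<and> X t \<omega> = a})"

text \<open>\<open>F\<close> is the distribution function of the absorption time in \<open>a\<close> when the initial state has
  law \<open>\<alpha>\<close>; mass of \<open>\<alpha>\<close> at \<open>a\<close> (an atom of \<open>F\<close> at \<open>0\<close>) is allowed.\<close>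

definition phase_type_df ::
    "('s::finite \<Rightarrow> 'p measure) \<Rightarrow> (real \<Rightarrow> 'p \<Rightarrow> 's) \<Rightarrow> 's \<Rightarrow> 's pmf \<Rightarrow> (real \<Rightarrow> real) \<Rightarrow> bool"
  where
  "phase_type_df P X a \<alpha> F \<longleftrightarrow>
     markov_jump_process P X \<and> absorbing_state P X a \<and> (\<forall>i. i \<noteq> a \<longrightarrow> transient_state P X i) \<and>
     (\<forall>u. F u = (\<Sum>i\<in>UNIV. pmf \<alpha> i *
        measure (P i) {\<omega> \<in> space (P i). absorption_time X a \<omega> \<le> ereal u}))"


section \<open>The compound Poisson risk model with premium rate one\<close>

text \<open>The Poisson arrival process is given by its i.i.d. exponential interarrival times \<open>T\<close>,
  and \<open>U\<close> are the claim sizes. The \<open>k\<close>-th claim, counting from \<open>0\<close>, arrives at time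
  \<open>T 0 + \<dots> + T k\<close>.\<close>

definition compound_poisson_model ::
    "'r measure \<Rightarrow> real \<Rightarrow> (real \<Rightarrow> real) \<Rightarrow> (nat \<Rightarrow> 'r \<Rightarrow> real) \<Rightarrow> (nat \<Rightarrow> 'r \<Rightarrow> real) \<Rightarrow> bool"
  where
  "compound_poisson_model R rate F T U \<longleftrightarrow>
     prob_space R \<and>
     prob_space.indep_vars R (\<lambda>_. borel) (case_sum T U) UNIV \<and>
     (\<forall>k. distributed R lborel (T k) (exponential_density rate)) \<and>
     (\<forall>k. cdf (distr R borel (U k)) = F)"

definition arrival_time :: "(nat \<Rightarrow> 'r \<Rightarrow> real) \<Rightarrow> nat \<Rightarrow> 'r \<Rightarrow> real" where
  "arrival_time T k \<omega> = (\<Sum>i\<le>k. T i \<omega>)"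

text \<open>Claims that have arrived by time \<open>t\<close> minus premiums \<open>t\<close>. The series has almost surely
  finitely many nonzero terms; it is taken in \<^typ>\<open>ennreal\<close> (claims are almost surely
  nonnegative) so that no junk values arise on null events.\<close>

definition claim_surplus ::
    "(nat \<Rightarrow> 'r \<Rightarrow> real) \<Rightarrow> (nat \<Rightarrow> 'r \<Rightarrow> real) \<Rightarrow> real \<Rightarrow> 'r \<Rightarrow> ereal" where
  "claim_surplus T U t \<omega> =
     enn2ereal (\<Sum>k. ennreal (U k \<omega>) * indicator {..t} (arrival_time T k \<omega>)) - ereal t"

definition max_surplus :: "(nat \<Rightarrow> 'r \<Rightarrow> real) \<Rightarrow> (nat \<Rightarrow> 'r \<Rightarrow> real) \<Rightarrow> 'r \<Rightarrow> ereal" where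
  "max_surplus T U \<omega> = (SUP t\<in>{0..}. claim_surplus T U t \<omega>)"

definition ruin_prob ::
    "'r measure \<Rightarrow> (nat \<Rightarrow> 'r \<Rightarrow> real) \<Rightarrow> (nat \<Rightarrow> 'r \<Rightarrow> real) \<Rightarrow> real \<Rightarrow> real" where
  "ruin_prob R T U u = measure R {\<omega> \<in> space R. max_surplus T U \<omega> > ereal u}"

end

theory Submission
  imports Defs
begin

text \<open>With \<open>q = \<epsilon> \<theta> / (1 - \<rho>b)\<close> and \<open>h\<close> the tail of the excess distribution, the claimed limit of
  \<open>\<psi> / h\<close> is \<open>(1 - q) (q + 2 q\<^sup>2 + \<dots> + n q\<^sup>n)\<close>. The tail of a maximum of \<open>k\<close> independent copies is
  asymptotic to \<open>k h\<close>. Everything coming from the phase-type model is negligible: a finite Markov chain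
  is absorbed geometrically fast, so the claims have an exponential moment, and by the net profit
  condition some exponential moment \<open>r\<close> of a single step of the embedded random walk is less than one;
  summing the Chernoff bounds \<open>r\<^sup>k exp (- \<gamma> u)\<close> over all steps shows that the supremum has an
  exponentially decaying tail. A subexponential tail is long-tailed, hence decays more slowly than any
  exponential, and dominated convergence gives that adding an independent summand with an exponential
  moment does not change it asymptotically.\<close>


section \<open>Absorption of finite Markov jump processes\<close>

definition transition_prob ::
    "('s::finite \<Rightarrow> 'p measure) \<Rightarrow> (real \<Rightarrow> 'p \<Rightarrow> 's) \<Rightarrow> real \<Rightarrow> 's \<Rightarrow> 's \<Rightarrow> real" where
  "transition_prob P X t i j = measure (P i) {\<omega> \<in> space (P i). X t \<omega> = j}"

context
  fixes P :: "'s::finite \<Rightarrow> 'p measure" and X :: "real \<Rightarrow> 'p \<Rightarrow> 's"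
  assumes mjp: "markov_jump_process P X"
begin

lemma mjp_prob_space: "prob_space (P i)"
  and mjp_measurable: "0 \<le> t \<Longrightarrow> X t \<in> measurable (P i) (count_space UNIV)"
  and mjp_right_cont: "\<omega> \<in> space (P i) \<Longrightarrow> 0 \<le> t \<Longrightarrow>
         eventually (\<lambda>s. X s \<omega> = X t \<omega>) (at_right t)"
  and mjp_start: "AE \<omega> in P i. X 0 \<omega> = i"
  using mjp unfolding markov_jump_process_def by blast+

lemma mjp_event: "0 \<le> t \<Longrightarrow> {\<omega> \<in> space (P i). X t \<omega> = j} \<in> sets (P i)"
  using measurable_sets[OF mjp_measurable[of t i], of "{j}"]
  by (auto simp: vimage_def Int_def conj_commute)

lemma transition_prob_nonneg: "0 \<le> transition_prob P X t i j"
  by (simp add: transition_prob_def)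

lemma transition_prob_0: "transition_prob P X 0 i i = 1"
proof -
  interpret prob_space "P i" by (rule mjp_prob_space)
  show ?thesis unfolding transition_prob_def
    by (rule prob_eq_1[THEN iffD2]) (use mjp_start[of i] in \<open>auto intro!: mjp_event\<close>)
qed

lemma sum_transition_prob: "0 \<le> t \<Longrightarrow> (\<Sum>j\<in>UNIV. transition_prob P X t i j) = 1"
proof -
  assume t: "0 \<le> t"
  interpret prob_space "P i" by (rule mjp_prob_space)
  have "(\<Sum>j\<in>UNIV. transition_prob P X t i j) = prob (\<Union>j. {\<omega> \<in> space (P i). X t \<omega> = j})"
    unfolding transition_prob_def
    by (rule finite_measure_finite_Union[symmetric])
       (use t in \<open>auto simp: disjoint_family_on_def intro!: mjp_event\<close>)
  also have "(\<Union>j. {\<omega> \<in> space (P i). X t \<omega> = j}) = space (P i)" by auto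
  finally show ?thesis by (simp add: prob_space)
qed

lemma prob_two_times:
  assumes "0 \<le> s" "0 \<le> t"
  shows "measure (P i) {\<omega> \<in> space (P i). X s \<omega> = k \<and> X (s + t) \<omega> = j} =
         transition_prob P X s i k * transition_prob P X t k j"
proof -
  \<comment> \<open>With \<open>n = 0\<close> the Markov clause looks only at indices 0 and 1, so
    any continuation of the time and state sequences will do.\<close>
  define tt where "tt = (\<lambda>n::nat. if n = 0 then s else s + t)"
  define x where "x = (\<lambda>n::nat. if n = 0 then k else j)"
  have "\<forall>i (n::nat) (t::nat \<Rightarrow> real) (x::nat \<Rightarrow> 's).
        0 \<le> t 0 \<and> (\<forall>k\<le>n. t k \<le> t (Suc k)) \<longrightarrow>
        measure (P i) {\<omega> \<in> space (P i). \<forall>k\<le>Suc n. X (t k) \<omega> = x k} =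
        measure (P i) {\<omega> \<in> space (P i). \<forall>k\<le>n. X (t k) \<omega> = x k} *
        measure (P (x n)) {\<omega> \<in> space (P (x n)). X (t (Suc n) - t n) \<omega> = x (Suc n)}"
    using mjp unfolding markov_jump_process_def by blast
  from this[rule_format, of tt 0 i x] assms
  have "measure (P i) {\<omega> \<in> space (P i). \<forall>k\<le>Suc 0. X (tt k) \<omega> = x k} =
        measure (P i) {\<omega> \<in> space (P i). \<forall>k\<le>0. X (tt k) \<omega> = x k} *
        measure (P (x 0)) {\<omega> \<in> space (P (x 0)). X (tt (Suc 0) - tt 0) \<omega> = x (Suc 0)}"
    by (auto simp: tt_def)
  moreover have "(\<forall>k\<le>Suc 0. Q k) \<longleftrightarrow> Q 0 \<and> Q (Suc 0)" for Q :: "nat \<Rightarrow> bool"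
    by (auto simp: le_Suc_eq)
  ultimately show ?thesis
    unfolding transition_prob_def by (simp add: tt_def x_def)
qed

lemma chapman_kolmogorov:
  assumes "0 \<le> s" "0 \<le> t"
  shows "transition_prob P X (s + t) i j =
         (\<Sum>k\<in>UNIV. transition_prob P X s i k * transition_prob P X t k j)"
proof -
  interpret prob_space "P i" by (rule mjp_prob_space)
  have ev: "{\<omega> \<in> space (P i). X s \<omega> = k \<and> X (s + t) \<omega> = j} \<in> events" for k
    using sets.Int[OF mjp_event[of s i k] mjp_event[of "s + t" i j]] assms
    by (auto simp: Int_def conj_ac cong: conj_cong elim!: back_subst[of "\<lambda>A. A \<in> events"])
  have "(\<Sum>k\<in>UNIV. transition_prob P X s i k * transition_prob P X t k j) =
        (\<Sum>k\<in>UNIV. prob {\<omega> \<in> space (P i). X s \<omega> = k \<and> X (s + t) \<omega> = j})"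
    using prob_two_times[OF assms] by simp
  also have "\<dots> = prob (\<Union>k. {\<omega> \<in> space (P i). X s \<omega> = k \<and> X (s + t) \<omega> = j})"
    by (rule finite_measure_finite_Union[symmetric])
       (use ev in \<open>auto simp: disjoint_family_on_def\<close>)
  also have "(\<Union>k. {\<omega> \<in> space (P i). X s \<omega> = k \<and> X (s + t) \<omega> = j}) =
             {\<omega> \<in> space (P i). X (s + t) \<omega> = j}" by auto
  finally show ?thesis by (simp add: transition_prob_def)
qed

text \<open>One term of the nonnegative Chapman-Kolmogorov sum. This makes accessibility transitive
  and absorption monotone in time.\<close>

lemma transition_prob_mult_le:
  assumes "0 \<le> s" "0 \<le> t"
  shows "transition_prob P X s i k * transition_prob P X t k j \<le> transition_prob P X (s + t) i j"
  unfolding chapman_kolmogorov[OF assms]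
  by (rule member_le_sum[of k UNIV "\<lambda>k. transition_prob P X s i k * transition_prob P X t k j"])
     (auto simp: transition_prob_nonneg)

text \<open>Almost every path leaves \<open>j\<close> for good after some time, so the indicator of
  being in \<open>j\<close> tends to zero and dominated convergence applies.\<close>

lemma transient_transition_prob_tendsto_0:
  assumes tr: "transient_state P X j"
  shows "((\<lambda>t. transition_prob P X t j j) \<longlongrightarrow> 0) at_top"
proof -
  interpret prob_space "P j" by (rule mjp_prob_space)
  \<comment> \<open>Measurability of \<open>X t\<close> is given only for nonnegative times, hence
    the truncation.\<close>
  let ?A = "\<lambda>t. {\<omega> \<in> space (P j). X (max 0 t) \<omega> = j}"
  have "((\<lambda>t. \<integral>\<omega>. indicator (?A t) \<omega> \<partial>P j) \<longlongrightarrow> (\<integral>\<omega>. (0::real) \<partial>P j)) at_top"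
  proof (rule integral_dominated_convergence_at_top[where w = "\<lambda>_. 1"])
    show "AE \<omega> in P j. ((\<lambda>t. indicator (?A t) \<omega> :: real) \<longlongrightarrow> 0) at_top"
      using tr unfolding transient_state_def
    proof (eventually_elim)
      case (elim \<omega>)
      then obtain b where b: "\<And>t. 0 \<le> t \<Longrightarrow> X t \<omega> = j \<Longrightarrow> t \<le> b"
        unfolding bdd_above_def by auto
      have "\<forall>\<^sub>F t in at_top. (indicator (?A t) \<omega> :: real) = 0"
        using eventually_gt_at_top[of b]
      proof eventually_elim
        case (elim t)
        with b[of "max 0 t"] show ?case by (auto simp: indicator_def)
      qed
      then show ?case by (rule tendsto_eventually)
    qed
  qed (simp_all add: borel_measurable_indicator[OF mjp_event])
  then have "((\<lambda>t. transition_prob P X (max 0 t) j j) \<longlongrightarrow> 0) at_top"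
    by (simp add: transition_prob_def mjp_event Int_absorb2 subset_eq)
  then show ?thesis
    by (rule Lim_transform_eventually)
       (use eventually_ge_at_top[of 0] in eventually_elim, simp add: max_def)
qed

section \<open>Accessibility of the absorbing state\<close>

definition reach :: "'s \<Rightarrow> 's set" where
  "reach i = {j. \<exists>t\<ge>0. 0 < transition_prob P X t i j}"

lemma reach_refl: "i \<in> reach i"
  unfolding reach_def using transition_prob_0[of i] by (auto intro!: exI[of _ 0])

lemma reach_trans: "j \<in> reach i \<Longrightarrow> reach j \<subseteq> reach i"
proof
  fix k assume "j \<in> reach i" "k \<in> reach j"
  then obtain s t where st: "0 \<le> s" "0 < transition_prob P X s i j"
      "0 \<le> t" "0 < transition_prob P X t j k" unfolding reach_def by auto
  have "0 < transition_prob P X s i j * transition_prob P X t j k" using st by simp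
  also have "\<dots> \<le> transition_prob P X (s + t) i k" using st by (intro transition_prob_mult_le)
  finally show "k \<in> reach i" using st unfolding reach_def by (auto intro!: exI[of _ "s + t"])
qed

text \<open>In a reachable set of minimal cardinality all states communicate; if they were all transient,
  every entry of the corresponding row of the transition matrix would tend to zero, although the
  row sums to one.\<close>

lemma absorbing_state_reachable:
  assumes tr: "\<And>j. j \<noteq> a \<Longrightarrow> transient_state P X j"
  shows "a \<in> reach i"
proof -
  obtain k where k: "k \<in> reach i" and min: "\<And>j. j \<in> reach i \<Longrightarrow> card (reach k) \<le> card (reach j)"
    using ex_has_least_nat[of "\<lambda>k. k \<in> reach i" i "\<lambda>k. card (reach k)"] reach_refl by blast
  have eq: "reach j = reach k" if "j \<in> reach k" for j
    using card_seteq[OF finite reach_trans[OF that]] min[of j] reach_trans[OF k] that by blast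
  have "a \<in> reach k"
  proof (rule ccontr)
    assume na: "a \<notin> reach k"
    have lim: "((\<lambda>t. transition_prob P X t k j) \<longlongrightarrow> 0) at_top" for j
    proof (cases "j \<in> reach k")
      case False
      have "\<forall>\<^sub>F t in at_top. transition_prob P X t k j = 0"
        using eventually_ge_at_top[of 0]
      proof eventually_elim
        case (elim t)
        then show ?case using False transition_prob_nonneg[of t k j]
          unfolding reach_def by (auto simp: not_less intro: antisym)
      qed
      then show ?thesis by (rule tendsto_eventually)
    next
      case True
      then have ja: "j \<noteq> a" "k \<in> reach j" using na eq[OF True] reach_refl by (metis, metis)
      then obtain s where s: "0 \<le> s" "0 < transition_prob P X s j k"
        unfolding reach_def by auto
      \<comment> \<open>Moving from \<open>j\<close> to \<open>k\<close> in the fixed time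
        \<open>s\<close> and back in time \<open>t\<close> is a return to \<open>j\<close>; dividing
        by the fixed positive first factor bounds the way from \<open>k\<close> to
        \<open>j\<close>.\<close>
      have "((\<lambda>t. transition_prob P X (s + t) j j) \<longlongrightarrow> 0) at_top"
        using filterlim_compose[OF transient_transition_prob_tendsto_0[OF tr[OF ja(1)]]
            filterlim_tendsto_add_at_top[OF tendsto_const filterlim_ident]] .
      then have z: "((\<lambda>t. transition_prob P X (s + t) j j / transition_prob P X s j k) \<longlongrightarrow> 0) at_top"
        using tendsto_divide_zero by blast
      show ?thesis
      proof (rule tendsto_sandwich[OF _ _ tendsto_const z])
        show "\<forall>\<^sub>F t in at_top. transition_prob P X t k j
                 \<le> transition_prob P X (s + t) j j / transition_prob P X s j k"
          using eventually_ge_at_top[of 0]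
        proof eventually_elim
          case (elim t)
          then show ?case
            using transition_prob_mult_le[of s t j k j] s by (simp add: field_simps)
        qed
      qed (simp add: transition_prob_nonneg)
    qed
    have "((\<lambda>t. \<Sum>j\<in>UNIV. transition_prob P X t k j) \<longlongrightarrow> (\<Sum>j\<in>(UNIV::'s set). 0)) at_top"
      by (intro tendsto_sum lim)
    moreover have "((\<lambda>t. \<Sum>j\<in>UNIV. transition_prob P X t k j) \<longlongrightarrow> 1) at_top"
      by (rule tendsto_eventually)
         (use eventually_ge_at_top[of 0] in eventually_elim, simp add: sum_transition_prob)
    ultimately show False
      using tendsto_unique[OF trivial_limit_at_top_linorder] by fastforce
  qed
  then show ?thesis using reach_trans[OF k] by auto
qed

text \<open>Since there are finitely many states, one time \<open>t0\<close> gives every state a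
  chance of at least \<open>1 - r\<close> to be in \<open>a\<close>. Conditioning on the state at
  \<open>t0\<close> then gains a factor \<open>r\<close> per period.\<close>

lemma not_absorbed_geometric:
  assumes abs: "absorbing_state P X a" and tr: "\<And>j. j \<noteq> a \<Longrightarrow> transient_state P X j"
  obtains t0 r where "0 < t0" "0 < r" "r < 1"
    "\<And>n i. 1 - transition_prob P X (real n * t0) i a \<le> r ^ n"
    "\<And>s t i. 0 \<le> s \<Longrightarrow> s \<le> t \<Longrightarrow> transition_prob P X s i a \<le> transition_prob P X t i a"
proof -
  have paa: "transition_prob P X t a a = 1" if "0 \<le> t" for t
  proof -
    interpret prob_space "P a" by (rule mjp_prob_space)
    show ?thesis unfolding transition_prob_def
      by (rule prob_eq_1[THEN iffD2])
         (use abs that in \<open>auto simp: absorbing_state_def intro!: mjp_event\<close>)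
  qed
  have mono: "transition_prob P X s i a \<le> transition_prob P X t i a" if "0 \<le> s" "s \<le> t" for s t i
    using transition_prob_mult_le[of s "t - s" i a a] that paa[of "t - s"] by simp
  have "\<exists>t\<ge>0. 0 < transition_prob P X t i a" for i
    using absorbing_state_reachable[OF tr] unfolding reach_def by auto
  then obtain \<tau> where \<tau>: "\<And>i. 0 \<le> \<tau> i" "\<And>i. 0 < transition_prob P X (\<tau> i) i a" by metis
  \<comment> \<open>Dominates every \<open>\<tau> i\<close>; the added 1 keeps it positive if they
    are all zero.\<close>
  define t0 where "t0 = (\<Sum>i\<in>UNIV. \<tau> i) + 1"
  have \<tau>t0: "\<tau> i \<le> t0" for i
    using member_le_sum[of i UNIV \<tau>] \<tau>(1) unfolding t0_def by auto
  have t0: "0 < t0" using sum_nonneg[of UNIV \<tau>] \<tau>(1) unfolding t0_def by (simp add: add_nonneg_pos)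
  \<comment> \<open>The inserted 1/2 keeps \<open>r\<close> positive, so that \<open>ln r\<close>
    and \<open>1 / r\<close> can be used later.\<close>
  define r where "r = Max (insert (1/2) (range (\<lambda>i. 1 - transition_prob P X t0 i a)))"
  have r_ge: "1 - transition_prob P X t0 i a \<le> r" for i
    unfolding r_def by (intro Max_ge) auto
  have r0: "0 < r" unfolding r_def by (subst Max_gr_iff) auto
  have r1: "r < 1"
    unfolding r_def using \<tau>(2) mono[OF \<tau>(1) \<tau>t0] by (subst Max_less_iff) (auto intro: less_le_trans)
  have "1 - transition_prob P X (real n * t0) i a \<le> r ^ n" for n i
  proof (induction n arbitrary: i)
    case 0
    then show ?case by (simp add: transition_prob_nonneg)
  next
    case (Suc n)
    have nt: "0 \<le> real n * t0" using t0 by simp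
    have "1 - transition_prob P X (real (Suc n) * t0) i a =
        (\<Sum>k\<in>UNIV. transition_prob P X t0 i k) -
        (\<Sum>k\<in>UNIV. transition_prob P X t0 i k * transition_prob P X (real n * t0) k a)"
      using chapman_kolmogorov[of t0 "real n * t0" i a] t0 nt sum_transition_prob[of t0 i]
      by (simp add: algebra_simps)
    also have "\<dots> = (\<Sum>k\<in>UNIV. transition_prob P X t0 i k * (1 - transition_prob P X (real n * t0) k a))"
      by (simp add: sum_subtractf right_diff_distrib)
    \<comment> \<open>Paths already in \<open>a\<close> stay there and contribute nothing, which
      leaves the probability of not being in \<open>a\<close> at \<open>t0\<close> as the extra
      factor.\<close>
    also have "\<dots> \<le> (\<Sum>k\<in>UNIV. transition_prob P X t0 i k * (if k = a then 0 else r ^ n))"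
      using Suc.IH paa[OF nt]
      by (intro sum_mono mult_left_mono) (auto simp: transition_prob_nonneg)
    also have "\<dots> = (\<Sum>k\<in>UNIV - {a}. transition_prob P X t0 i k) * r ^ n"
      by (simp add: sum_distrib_right sum.remove[of UNIV a])
    also have "(\<Sum>k\<in>UNIV - {a}. transition_prob P X t0 i k) = 1 - transition_prob P X t0 i a"
      using sum_transition_prob[of t0 i] t0 by (simp add: sum.remove[of UNIV a])
    also have "\<dots> * r ^ n \<le> r * r ^ n"
      using r_ge r0 by (intro mult_right_mono) auto
    finally show ?case by simp
  qed
  with that t0 r0 r1 mono show thesis by blast
qed

text \<open>Monotonicity in time interpolates between the multiples of \<open>t0\<close>: the rate
  is \<open>- ln r / t0\<close>, and rounding \<open>u / t0\<close> down costs the factor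
  \<open>1 / r\<close>.\<close>

lemma not_absorbed_exponential:
  assumes abs: "absorbing_state P X a" and tr: "\<And>j. j \<noteq> a \<Longrightarrow> transient_state P X j"
  obtains D \<gamma> where "0 < \<gamma>"
    "\<And>u i. 0 \<le> u \<Longrightarrow> 1 - transition_prob P X u i a \<le> D * exp (- \<gamma> * u)"
proof -
  obtain t0 r where t0: "0 < t0" and r: "0 < r" "r < 1"
    and geo: "\<And>n i. 1 - transition_prob P X (real n * t0) i a \<le> r ^ n"
    and mono: "\<And>s t i. 0 \<le> s \<Longrightarrow> s \<le> t \<Longrightarrow> transition_prob P X s i a \<le> transition_prob P X t i a"
    using not_absorbed_geometric[OF assms] by blast
  have "1 - transition_prob P X u i a \<le> (1 / r) * exp (- (- ln r / t0) * u)" if u: "0 \<le> u" for u i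
  proof -
    define n where "n = nat \<lfloor>u / t0\<rfloor>"
    have n: "real n \<le> u / t0" "u / t0 - 1 \<le> real n"
      unfolding n_def using divide_nonneg_pos[OF u t0] by linarith+
    have "1 - transition_prob P X u i a \<le> 1 - transition_prob P X (real n * t0) i a"
      using mono[of "real n * t0" u i] n(1) t0 by (simp add: field_simps)
    also have "\<dots> \<le> r ^ n" by (rule geo)
    also have "\<dots> = exp (real n * ln r)" using r by (simp add: exp_of_nat_mult)
    also have "\<dots> \<le> exp ((u / t0 - 1) * ln r)"
      using n(2) r by (simp add: mult_right_mono_neg)
    also have "\<dots> = (1 / r) * exp (- (- ln r / t0) * u)"
      using r by (simp add: left_diff_distrib exp_diff)
    finally show ?thesis .
  qed
  then show thesis using that[of "- ln r / t0" "1 / r"] t0 r by (simp add: divide_neg_pos)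
qed

text \<open>Right-continuity of the paths replaces an uncountable infimum by a countable one, which
  is what makes the absorption time measurable.\<close>

lemma absorption_time_rational:
  assumes \<omega>: "\<omega> \<in> space (P i)"
  shows "absorption_time X a \<omega> = (INF q\<in>{0..} \<inter> \<rat>. if X q \<omega> = a then ereal q else \<infinity>)"
    (is "_ = ?R")
proof (rule antisym)
  show "absorption_time X a \<omega> \<le> ?R"
  proof (rule INF_greatest)
    show "absorption_time X a \<omega> \<le> (if X q \<omega> = a then ereal q else \<infinity>)" if "q \<in> {0..} \<inter> \<rat>" for q
      using that unfolding absorption_time_def by (simp add: Inf_lower)
  qed
  show "?R \<le> absorption_time X a \<omega>"
    unfolding absorption_time_def
  proof (rule Inf_greatest, clarify)
    fix t assume t: "0 \<le> t" "a = X t \<omega>"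
    show "(INF q\<in>{0..} \<inter> \<rat>. if X q \<omega> = X t \<omega> then ereal q else \<infinity>) \<le> ereal t"
    proof (rule dense_ge)
      fix z assume z: "ereal t < z"
      then obtain y where y: "t < y" "ereal y \<le> z"
        using ereal_dense2[OF z] by auto
      \<comment> \<open>The path keeps its state on \<open>(t, b)\<close>, and this interval
        contains a rational time below \<open>y\<close>.\<close>
      obtain b where b: "t < b" "\<And>s. t < s \<Longrightarrow> s < b \<Longrightarrow> X s \<omega> = X t \<omega>"
        using mjp_right_cont[OF \<omega> t(1)] unfolding eventually_at_right_field by blast
      obtain q where q: "q \<in> \<rat>" "t < q" "q < min b y"
        using Rats_dense_in_real[of t "min b y"] y b by auto
      have "(INF q\<in>{0..} \<inter> \<rat>. if X q \<omega> = X t \<omega> then ereal q else \<infinity>)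
             \<le> (if X q \<omega> = X t \<omega> then ereal q else \<infinity>)"
        using q t by (intro INF_lower) auto
      also have "\<dots> \<le> ereal y" using b(2)[of q] q by auto
      finally show "(INF q\<in>{0..} \<inter> \<rat>. if X q \<omega> = X t \<omega> then ereal q else \<infinity>) \<le> z"
        using y(2) by (rule order_trans)
    qed
  qed
qed

lemma absorption_time_event: "{\<omega> \<in> space (P i). absorption_time X a \<omega> \<le> ereal u} \<in> sets (P i)"
proof -
  have "(\<lambda>\<omega>. INF q\<in>{0..} \<inter> \<rat>. if X q \<omega> = a then ereal q else \<infinity>) \<in> borel_measurable (P i)"
  proof (rule borel_measurable_INF)
    show "countable ({0..} \<inter> \<rat> :: real set)" using countable_rat by (rule countable_Int2)
    show "(\<lambda>\<omega>. if X q \<omega> = a then ereal q else \<infinity>) \<in> borel_measurable (P i)"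
      if "q \<in> {0..} \<inter> \<rat>" for q
      using that by (intro measurable_If mjp_event) auto
  qed
  then have "absorption_time X a \<in> borel_measurable (P i)"
    by (rule measurable_cong[THEN iffD2, rotated]) (rule absorption_time_rational)
  then show ?thesis by measurable
qed

end

lemma phase_type_df_negative: "phase_type_df P X a \<alpha> F \<Longrightarrow> u < 0 \<Longrightarrow> F u = 0"
proof -
  assume "phase_type_df P X a \<alpha> F" and u: "u < 0"
  moreover have "0 \<le> absorption_time X a \<omega>" for \<omega>
    unfolding absorption_time_def by (intro Inf_greatest) auto
  then have "\<not> absorption_time X a \<omega> \<le> ereal u" for \<omega>
    using u by (metis ereal_less(2) ereal_less_eq(5) not_le order_trans)
  ultimately show ?thesis by (simp add: phase_type_df_def)
qed

text \<open>Being in \<open>a\<close> at time \<open>u\<close> forces absorption by time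
  \<open>u\<close>. The bound is uniform in the initial state, so it survives mixing with the
  weights of \<open>\<alpha>\<close>.\<close>

lemma phase_type_df_exponential_tail:
  fixes P :: "'s::finite \<Rightarrow> 'p measure"
  assumes ph: "phase_type_df P X a \<alpha> F"
  obtains D \<gamma> where "0 < \<gamma>" "\<And>u. 0 \<le> u \<Longrightarrow> 1 - F u \<le> D * exp (- \<gamma> * u)"
proof -
  have mjp: "markov_jump_process P X" and abs: "absorbing_state P X a"
    and tr: "\<And>i. i \<noteq> a \<Longrightarrow> transient_state P X i"
    and F: "\<And>u. F u = (\<Sum>i\<in>UNIV. pmf \<alpha> i *
        measure (P i) {\<omega> \<in> space (P i). absorption_time X a \<omega> \<le> ereal u})"
    using ph unfolding phase_type_df_def by auto
  obtain D \<gamma> where g: "0 < \<gamma>"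
    and D: "\<And>u i. 0 \<le> u \<Longrightarrow> 1 - transition_prob P X u i a \<le> D * exp (- \<gamma> * u)"
    using not_absorbed_exponential[OF mjp abs tr] by metis
  have sum1: "(\<Sum>i\<in>UNIV. pmf \<alpha> i) = 1" by (simp add: sum_pmf_eq_1)
  have "1 - F u \<le> D * exp (- \<gamma> * u)" if u: "0 \<le> u" for u
  proof -
    have le: "transition_prob P X u i a \<le>
          measure (P i) {\<omega> \<in> space (P i). absorption_time X a \<omega> \<le> ereal u}" for i
    proof -
      interpret prob_space "P i" by (rule mjp_prob_space[OF mjp])
      show ?thesis
        unfolding transition_prob_def
        by (rule finite_measure_mono[OF _ absorption_time_event[OF mjp]])
           (use u in \<open>auto simp: absorption_time_def intro!: Inf_lower\<close>)
    qed
    have "1 - F u = (\<Sum>i\<in>UNIV. pmf \<alpha> i *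
        (1 - measure (P i) {\<omega> \<in> space (P i). absorption_time X a \<omega> \<le> ereal u}))"
      unfolding F by (simp add: right_diff_distrib sum_subtractf sum1)
    also have "\<dots> \<le> (\<Sum>i\<in>UNIV. pmf \<alpha> i * (D * exp (- \<gamma> * u)))"
      by (intro sum_mono mult_left_mono order_trans[OF diff_left_mono[OF le] D[OF u]]) simp
    also have "\<dots> = D * exp (- \<gamma> * u)" by (simp add: sum_distrib_right[symmetric] sum1)
    finally show ?thesis .
  qed
  with that g show thesis by blast
qed


section \<open>Long-tailed distributions\<close>

lemma (in real_distribution) AE_nonneg_of_cdf:
  assumes "\<And>x. x < 0 \<Longrightarrow> cdf M x = 0"
  shows "AE x in M. 0 \<le> x"
proof -
  have "(\<Union>n. {..- inverse (real (Suc n))}) \<in> null_sets M"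
    using assms by (intro null_sets_UN) (auto simp: null_sets_def cdf_def emeasure_eq_measure)
  moreover have "{x. \<not> 0 \<le> x} \<subseteq> (\<Union>n. {..- inverse (real (Suc n))})"
  proof
    fix x :: real assume "x \<in> {x. \<not> 0 \<le> x}"
    then obtain n where "inverse (real (Suc n)) < - x" using reals_Archimedean[of "- x"] by auto
    then show "x \<in> (\<Union>n. {..- inverse (real (Suc n))})" by (auto intro!: exI[of _ n])
  qed
  ultimately show ?thesis by (intro AE_I'[where N = "\<Union>n. {..- inverse (real (Suc n))}"]) simp_all
qed

lemma (in real_distribution) tail_eq_cdf: "measure M {u<..} = 1 - cdf M u"
proof -
  have "{u<..} = space M - {..u}" by auto
  then show ?thesis using prob_compl[of "{..u}"] by (simp add: cdf_def)
qed

lemma borel_measurable_cdf: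
  assumes "real_distribution N"
  shows "cdf N \<in> borel_measurable borel"
proof -
  interpret N: real_distribution N by fact
  show ?thesis by (intro borel_measurable_mono monoI N.cdf_nondecreasing)
qed

lemma distribution_function_nonneg_real_distribution:
  assumes "distribution_function_nonneg F"
  shows "real_distribution (interval_measure F)" and "cdf (interval_measure F) = F"
proof -
  have "eventually (\<lambda>x. F x = 0) at_bot"
    using eventually_gt_at_bot[of 0] assms unfolding distribution_function_nonneg_def
    by (auto elim: eventually_mono intro: eventually_at_bot_linorderI[of "-1"])
  then have "(F \<longlongrightarrow> 0) at_bot" by (rule tendsto_eventually)
  then show "real_distribution (interval_measure F)" and "cdf (interval_measure F) = F"
    using assms unfolding distribution_function_nonneg_def
    by (auto intro!: real_distribution_interval_measure cdf_interval_measure dest: monoD)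
qed

text \<open>\<open>convolution_power\<close> ends in the point mass at 0; removing it identifies the
  second power with a plain convolution.\<close>

lemma convolution_return_0:
  fixes N :: "real measure"
  assumes "real_distribution N"
  shows "(N \<star> return borel 0) = N"
proof (rule measure_eqI)
  interpret N: real_distribution N by fact
  interpret r: prob_space "return borel (0::real)" by (rule prob_space_return) simp
  show "sets (N \<star> return borel 0) = sets N" by simp
  fix A assume "A \<in> sets (N \<star> return borel 0)"
  then have A: "A \<in> sets borel" by simp
  have A': "{a. a + x \<in> A} \<in> sets borel" for x :: real
    using measurable_sets[OF borel_measurable_add[OF measurable_ident[of borel] borel_measurable_const[of x]] A]
    by (simp add: vimage_def)
  have "emeasure (N \<star> return borel 0) A = (\<integral>\<^sup>+x. emeasure (return borel 0) {a. a + x \<in> A} \<partial>N)"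
    using A by (intro convolution_emeasure) (auto simp: N.finite_measure_axioms r.finite_measure_axioms)
  also have "\<dots> = (\<integral>\<^sup>+x. indicator A x \<partial>N)"
    using A' by (intro nn_integral_cong) (auto simp: emeasure_return indicator_def)
  also have "\<dots> = emeasure N A" using A by simp
  finally show "emeasure (N \<star> return borel 0) A = emeasure N A" .
qed

lemma real_distribution_convolution:
  assumes "real_distribution M" "real_distribution N"
  shows "real_distribution (M \<star> N)"
proof -
  interpret M: real_distribution M by fact
  interpret N: real_distribution N by fact
  interpret pair_prob_space M N ..
  show ?thesis unfolding convolution_def by (rule real_distribution_distr) measurable
qed

text \<open>Conditioning on the first summand. The integral form serves both the lower bound for
  subexponential tails and dominated convergence.\<close>

lemma convolution_tail:
  assumes M: "real_distribution M" and N: "real_distribution N"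
  shows "1 - cdf (M \<star> N) u = (\<integral>x. 1 - cdf N (u - x) \<partial>M)"
proof -
  interpret M: real_distribution M by fact
  interpret N: real_distribution N by fact
  interpret MN: real_distribution "M \<star> N" by (rule real_distribution_convolution) fact+
  have meas: "(\<lambda>x. 1 - cdf N (u - x)) \<in> borel_measurable M"
    using borel_measurable_cdf[OF N] by measurable
  have "emeasure (M \<star> N) {u<..} = (\<integral>\<^sup>+x. emeasure N {a. a + x \<in> {u<..}} \<partial>M)"
    by (intro convolution_emeasure) (auto simp: N.finite_measure_axioms M.finite_measure_axioms)
  also have "\<dots> = (\<integral>\<^sup>+x. ennreal (1 - cdf N (u - x)) \<partial>M)"
  proof (rule nn_integral_cong)
    fix x
    have "{a. a + x \<in> {u<..}} = {u - x<..}" by auto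
    then show "emeasure N {a. a + x \<in> {u<..}} = ennreal (1 - cdf N (u - x))"
      by (simp add: N.emeasure_eq_measure N.tail_eq_cdf)
  qed
  also have "\<dots> = ennreal (\<integral>x. 1 - cdf N (u - x) \<partial>M)"
    by (rule nn_integral_eq_integral, rule M.integrable_const_bound[of _ 1])
       (auto simp: meas N.cdf_bounded_prob N.cdf_nonneg)
  finally show ?thesis
    by (subst (asm) MN.emeasure_eq_measure)
       (simp add: MN.tail_eq_cdf N.cdf_bounded_prob MN.cdf_bounded_prob integral_nonneg_AE)
qed

text \<open>The tail of the sum of two independent copies is bounded below by splitting according to
  whether one of them is at most \<open>y\<close>, lies in \<open>(y, u]\<close>, or exceeds \<open>u\<close>; the middle part
  carries the factor \<open>1 - F (u - y)\<close>.\<close>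

lemma subexponential_long_tailed:
  assumes sub: "subexponential F" and y: "0 \<le> y"
  shows "((\<lambda>u. (1 - F (u - y)) / (1 - F u)) \<longlongrightarrow> 1) at_top"
proof -
  define N where "N = interval_measure F"
  have df: "distribution_function_nonneg F" and pos: "\<And>u. 1 - F u > 0"
    and conv: "\<And>n. n \<ge> 1 \<Longrightarrow> (\<lambda>u. 1 - cdf (convolution_power (interval_measure F) n) u)
               \<sim>[at_top] (\<lambda>u. real n * (1 - F u))"
    using sub unfolding subexponential_def by auto
  have N: "real_distribution N" and cdfN: "cdf N = F"
    unfolding N_def using distribution_function_nonneg_real_distribution[OF df] by auto
  interpret N: real_distribution N by fact
  have mono: "F s \<le> F t" if "s \<le> t" for s t
    using df that unfolding distribution_function_nonneg_def by (auto dest: monoD)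
  have lim1: "(F \<longlongrightarrow> 1) at_top" using df unfolding distribution_function_nonneg_def by auto
  have AE0: "AE x in N. 0 \<le> x"
    by (rule N.AE_nonneg_of_cdf) (use df in \<open>auto simp: cdfN distribution_function_nonneg_def\<close>)
  define H where "H u = 1 - cdf (N \<star> N) u" for u
  have pow2: "convolution_power N 2 = (N \<star> N)"
    by (simp add: numeral_2_eq_2 convolution_return_0[OF N])
  have "((\<lambda>u. if H u = 0 \<and> 2 * (1 - F u) = 0 then 1 else H u / (2 * (1 - F u))) \<longlongrightarrow> 1) at_top"
    using conv[of 2] unfolding asymp_equiv_def N_def[symmetric] pow2 H_def of_nat_numeral by simp
  \<comment> \<open>Asymptotic equivalence assigns the quotient the value 1 where both sides vanish;
    the positive tail excludes that case.\<close>
  moreover have "(if H u = 0 \<and> 2 * (1 - F u) = 0 then 1 else H u / (2 * (1 - F u)))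
       = H u / (1 - F u) / 2" for u using pos[of u] by auto
  ultimately have "((\<lambda>u. 2 * (H u / (1 - F u) / 2)) \<longlongrightarrow> 2 * 1) at_top"
    by (intro tendsto_mult tendsto_const) simp
  moreover have "2 * (x / 2) = x" for x :: real by simp
  ultimately have H2: "((\<lambda>u. H u / (1 - F u)) \<longlongrightarrow> 2) at_top" by (simp only: mult_1_right)
  have F01: "0 \<le> F u" "F u \<le> 1" for u
    using N.cdf_nonneg[of u] N.cdf_bounded_prob[of u] by (auto simp: cdfN)
  have lower: "(1 - F u) + F y * (1 - F u) + (F u - F y) * (1 - F (u - y)) \<le> H u" if u: "y < u" for u
  proof -
    have meas: "(\<lambda>x. 1 - F (u - x)) \<in> borel_measurable N"
      using borel_measurable_cdf[OF N] unfolding cdfN by measurable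
    have Fy: "measure N {..y} = F y" using fun_cong[OF cdfN] by (simp add: cdf_def)
    let ?g = "\<lambda>x. indicator {u<..} x + (1 - F u) * indicator {..y} x
        + (1 - F (u - y)) * indicator {y<..u} x :: real"
    have "(\<integral>x. ?g x \<partial>N) = measure N {u<..} + (1 - F u) * measure N {..y}
        + (1 - F (u - y)) * measure N {y<..u}"
      by (simp add: N.emeasure_eq_measure)
    also have "\<dots> = (1 - F u) + F y * (1 - F u) + (F u - F y) * (1 - F (u - y))"
      using N.cdf_diff_eq[OF u] by (simp add: N.tail_eq_cdf cdfN Fy algebra_simps)
    finally have "(1 - F u) + F y * (1 - F u) + (F u - F y) * (1 - F (u - y)) = (\<integral>x. ?g x \<partial>N)" ..
    also have "\<dots> \<le> (\<integral>x. 1 - F (u - x) \<partial>N)"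
    proof (rule integral_mono_AE)
      show "integrable N (\<lambda>x. 1 - F (u - x))"
        by (rule N.integrable_const_bound[of _ 1]) (auto simp: meas F01)
      show "AE x in N. ?g x \<le> 1 - F (u - x)"
        using AE0
      proof eventually_elim
        case (elim x)
        have "F (u - x) = 0" if "u < x"
          using df that unfolding distribution_function_nonneg_def by auto
        then show ?case using elim mono[of "u - x" u] mono[of "u - x" "u - y"] u y
          by (auto simp: indicator_def)
      qed
    qed (simp add: N.emeasure_eq_measure)
    finally show ?thesis unfolding H_def convolution_tail[OF N N] cdfN .
  qed
  \<comment> \<open>This is \<open>lower\<close> solved for the shifted tail ratio; the limit 2 of
    \<open>H u / (1 - F u)\<close> is exactly what makes the bound tend to 1.\<close>
  have up: "((\<lambda>u. (H u / (1 - F u) - 1 - F y) / (F u - F y)) \<longlongrightarrow> (2 - 1 - F y) / (1 - F y)) at_top"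
    using pos[of y] by (intro tendsto_intros H2 lim1) auto
  show ?thesis
  proof (rule tendsto_sandwich[OF _ _ tendsto_const])
    show "((\<lambda>u. (H u / (1 - F u) - 1 - F y) / (F u - F y)) \<longlongrightarrow> 1) at_top"
      using up pos[of y] by simp
    show "\<forall>\<^sub>F u in at_top. 1 \<le> (1 - F (u - y)) / (1 - F u)"
      using pos mono y by (intro always_eventually) (auto simp: field_simps)
    have "\<forall>\<^sub>F u in at_top. F y < F u"
      using order_tendstoD(1)[OF lim1, of "F y"] pos[of y] by auto
    then show "\<forall>\<^sub>F u in at_top. (1 - F (u - y)) / (1 - F u) \<le> (H u / (1 - F u) - 1 - F y) / (F u - F y)"
      using eventually_gt_at_top[of y]
    proof eventually_elim
      case (elim u)
      have "(F u - F y) * (1 - F (u - y)) / (1 - F u) \<le> (H u - (1 - F u) - F y * (1 - F u)) / (1 - F u)"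
        using lower[OF elim(2)] pos[of u] by (intro divide_right_mono) auto
      also have "\<dots> = H u / (1 - F u) - 1 - F y"
        using pos[of u] by (simp add: diff_divide_distrib)
      finally show ?case using elim(1) by (simp add: field_simps)
    qed
  qed
qed

section \<open>Comparison of long tails with exponentials\<close>

text \<open>Beyond some \<open>u0\<close> a unit step to the left costs at most a factor
  \<open>exp \<kappa>\<close>, which can be iterated; below \<open>u0\<close> the tail is at least
  \<open>h u0\<close>. Uniformity in \<open>u\<close> makes the bound usable as a dominating
  function.\<close>

lemma long_tailed_shift_bound:
  fixes h :: "real \<Rightarrow> real"
  assumes pos: "\<And>u. 0 < h u" and le1: "\<And>u. h u \<le> 1" and anti: "\<And>s t. s \<le> t \<Longrightarrow> h t \<le> h s"
    and long: "((\<lambda>u. h (u - 1) / h u) \<longlongrightarrow> 1) at_top" and \<kappa>: "0 < \<kappa>"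
  obtains K where "0 < K" "\<And>u y. 0 \<le> y \<Longrightarrow> h (u - y) \<le> K * exp (\<kappa> * y) * h u"
proof -
  have "\<forall>\<^sub>F u in at_top. h (u - 1) / h u < exp \<kappa>"
    using \<kappa> by (intro order_tendstoD(2)[OF long]) simp
  then obtain u0 where u0: "\<And>u. u0 \<le> u \<Longrightarrow> h (u - 1) / h u < exp \<kappa>"
    unfolding eventually_at_top_linorder by blast
  have step: "h (u - real n) \<le> 1 / h u0 * exp (\<kappa> * real n) * h u" for u n
  proof (induction n arbitrary: u)
    case 0
    have "h u * h u0 \<le> h u" using pos[of u] le1[of u0] by (simp add: mult_left_le)
    then show ?case using pos[of u0] le1[of u0] pos[of u] by (simp add: field_simps)
  next
    case (Suc n)
    show ?case
    proof (cases "u0 \<le> u")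
      case True
      have "h (u - real (Suc n)) = h ((u - 1) - real n)" by (simp add: algebra_simps)
      also have "\<dots> \<le> 1 / h u0 * exp (\<kappa> * real n) * h (u - 1)" by (rule Suc.IH)
      also have "\<dots> \<le> 1 / h u0 * exp (\<kappa> * real n) * (exp \<kappa> * h u)"
        using u0[OF True] pos[of u] pos[of u0] by (intro mult_left_mono) (auto simp: field_simps)
      also have "\<dots> = 1 / h u0 * exp (\<kappa> * real (Suc n)) * h u"
        by (simp add: algebra_simps exp_add)
      finally show ?thesis .
    next
      case False
      \<comment> \<open>Left of \<open>u0\<close> the trivial bound 1 is enough, because
        \<open>h u / h u0\<close> is at least 1 there; this is why the constant is
        \<open>1 / h u0\<close>.\<close>
      have "h (u - real (Suc n)) \<le> 1 * 1" using le1 by simp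
      also have "\<dots> \<le> h u / h u0 * exp (\<kappa> * real (Suc n))"
        using anti[of u u0] False pos[of u0] \<kappa> by (intro mult_mono) auto
      finally show ?thesis by (simp add: mult.commute)
    qed
  qed
  have "h (u - y) \<le> (exp \<kappa> / h u0) * exp (\<kappa> * y) * h u" if y: "0 \<le> y" for u y
  proof -
    define n where "n = nat \<lceil>y\<rceil>"
    have n: "y \<le> real n" "real n \<le> y + 1" unfolding n_def using y by linarith+
    have "h (u - y) \<le> h (u - real n)" using n by (intro anti) simp
    also have "\<dots> \<le> 1 / h u0 * exp (\<kappa> * real n) * h u" by (rule step)
    also have "\<dots> \<le> 1 / h u0 * exp (\<kappa> * (y + 1)) * h u"
      using n \<kappa> pos[of u] pos[of u0] by (intro mult_right_mono mult_left_mono) auto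
    also have "\<dots> = (exp \<kappa> / h u0) * exp (\<kappa> * y) * h u"
      by (simp add: algebra_simps exp_add)
    finally show ?thesis .
  qed
  then show thesis using that[of "exp \<kappa> / h u0"] pos[of u0] by simp
qed

text \<open>The shift bound from \<open>u\<close> back to 0 with rate \<open>\<gamma> / 2\<close>
  shows that \<open>h\<close> loses at most half of the exponential rate.\<close>

lemma exponential_negligible_long_tailed:
  fixes h :: "real \<Rightarrow> real"
  assumes pos: "\<And>u. 0 < h u" and le1: "\<And>u. h u \<le> 1" and anti: "\<And>s t. s \<le> t \<Longrightarrow> h t \<le> h s"
    and long: "((\<lambda>u. h (u - 1) / h u) \<longlongrightarrow> 1) at_top" and \<gamma>: "0 < \<gamma>"
  shows "((\<lambda>u. exp (- \<gamma> * u) / h u) \<longlongrightarrow> 0) at_top"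
proof -
  obtain K where K: "0 < K" "\<And>u y. 0 \<le> y \<Longrightarrow> h (u - y) \<le> K * exp (\<gamma> / 2 * y) * h u"
    using long_tailed_shift_bound[OF pos le1 anti long, of "\<gamma> / 2"] \<gamma> by auto
  have "((\<lambda>u. exp (- (\<gamma> / 2 * u))) \<longlongrightarrow> 0) at_top"
    using \<gamma> by real_asymp
  then have z: "((\<lambda>u. K / h 0 * exp (- (\<gamma> / 2 * u))) \<longlongrightarrow> 0) at_top"
    using tendsto_mult_right_zero by blast
  show ?thesis
  proof (rule tendsto_sandwich[OF _ _ tendsto_const z])
    show "\<forall>\<^sub>F u in at_top. 0 \<le> exp (- \<gamma> * u) / h u"
      using pos by (intro always_eventually) (auto intro: less_imp_le)
    show "\<forall>\<^sub>F u in at_top. exp (- \<gamma> * u) / h u \<le> K / h 0 * exp (- (\<gamma> / 2 * u))"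
      using eventually_ge_at_top[of 0]
    proof eventually_elim
      case (elim u)
      have "exp (- \<gamma> * u) * h 0 \<le> exp (- \<gamma> * u) * (K * exp (\<gamma> / 2 * u) * h u)"
        using K(2)[OF elim, of u] by simp
      also have "\<dots> = K * (exp (- \<gamma> * u) * exp (\<gamma> / 2 * u)) * h u" by simp
      also have "exp (- \<gamma> * u) * exp (\<gamma> / 2 * u) = exp (- (\<gamma> / 2 * u))"
        unfolding exp_add[symmetric] by (simp add: field_simps)
      finally show ?case using pos[of 0] pos[of u] by (simp add: field_simps)
    qed
  qed
qed

text \<open>After division by the tail of \<open>N\<close>, the integrand of
  \<open>convolution_tail\<close> tends to 1 because \<open>N\<close> is long-tailed, and the shift
  bound supplies the integrable majorant \<open>K * exp (\<kappa> * x)\<close>.\<close>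

lemma convolution_light_long_tailed:
  assumes L: "real_distribution L" and N: "real_distribution N"
    and L0: "AE x in L. 0 \<le> x" and \<kappa>: "0 < \<kappa>" and int: "integrable L (\<lambda>x. exp (\<kappa> * x))"
    and pos: "\<And>u. cdf N u < 1"
    and long: "\<And>y. 0 \<le> y \<Longrightarrow> ((\<lambda>u. (1 - cdf N (u - y)) / (1 - cdf N u)) \<longlongrightarrow> 1) at_top"
  shows "((\<lambda>u. (1 - cdf (L \<star> N) u) / (1 - cdf N u)) \<longlongrightarrow> 1) at_top"
proof -
  interpret L: real_distribution L by fact
  interpret N: real_distribution N by fact
  let ?h = "\<lambda>u. 1 - cdf N u"
  obtain K where K: "0 < K" "\<And>u y. 0 \<le> y \<Longrightarrow> ?h (u - y) \<le> K * exp (\<kappa> * y) * ?h u"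
    using long_tailed_shift_bound[of ?h \<kappa>] pos N.cdf_nonneg N.cdf_nondecreasing long[of 1] \<kappa>
    by (auto simp: less_diff_eq)
  have "((\<lambda>u. \<integral>x. ?h (u - x) / ?h u \<partial>L) \<longlongrightarrow> (\<integral>x. 1 \<partial>L)) at_top"
  proof (rule integral_dominated_convergence_at_top[where w = "\<lambda>x. K * exp (\<kappa> * x)"])
    show "\<forall>\<^sub>F u in at_top. AE x in L. norm (?h (u - x) / ?h u) \<le> K * exp (\<kappa> * x)"
    proof (rule always_eventually, rule allI)
      fix u
      show "AE x in L. norm (?h (u - x) / ?h u) \<le> K * exp (\<kappa> * x)"
        using L0
      proof eventually_elim
        case (elim x)
        then show ?case using K(2)[OF elim, of u] pos[of u] N.cdf_bounded_prob[of "u - x"]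
          by (simp add: field_simps)
      qed
    qed
    show "AE x in L. ((\<lambda>u. ?h (u - x) / ?h u) \<longlongrightarrow> 1) at_top"
      using L0 by eventually_elim (rule long)
    show "(\<lambda>x. ?h (u - x) / ?h u) \<in> borel_measurable L" for u
      using borel_measurable_cdf[OF N] by measurable
  qed (use int in auto)
  then show ?thesis
    unfolding convolution_tail[OF L N] by (simp add: L.prob_space[simplified])
qed

text \<open>The quotient is a finite geometric sum in \<open>F u\<close>. It is the tail ratio of a
  maximum of \<open>k\<close> independent copies.\<close>

lemma one_minus_power_tendsto:
  fixes F :: "real \<Rightarrow> real"
  assumes "(F \<longlongrightarrow> 1) at_top" "\<And>u. F u < 1"
  shows "((\<lambda>u. (1 - F u ^ k) / (1 - F u)) \<longlongrightarrow> real k) at_top"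
proof -
  have "((\<lambda>u. \<Sum>i<k. F u ^ i) \<longlongrightarrow> (\<Sum>i<k. 1 ^ i)) at_top"
    by (intro tendsto_sum tendsto_power assms)
  moreover have "(1 - F u ^ k) / (1 - F u) = (\<Sum>i<k. F u ^ i)" for u
    using assms(2)[of u] one_diff_power_eq[of "F u" k] by (simp add: field_simps)
  ultimately show ?thesis by simp
qed


section \<open>Exponential decay of the ruin probability\<close>

text \<open>Rounding up to integers bounds the exponential by a series over the level sets
  \<open>?A n\<close>, whose expectation is dominated by a geometric series with ratio
  \<open>exp (\<kappa> - \<gamma>)\<close>.\<close>

lemma (in prob_space) integrable_exp_of_exponential_tail:
  assumes X[measurable]: "random_variable borel X"
    and tail: "\<And>u. 0 \<le> u \<Longrightarrow> prob {\<omega> \<in> space M. u < X \<omega>} \<le> D * exp (- \<gamma> * u)"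
    and \<kappa>: "0 < \<kappa>" "\<kappa> < \<gamma>"
  shows "integrable M (\<lambda>\<omega>. exp (\<kappa> * X \<omega>))"
proof (rule integrableI_bounded)
  have D: "0 \<le> D" using order_trans[OF measure_nonneg tail[of 0]] by simp
  let ?A = "\<lambda>n. {\<omega> \<in> space M. real n < X \<omega>}"
  have le: "g n \<le> suminf g" for g :: "nat \<Rightarrow> ennreal" and n
    using sum_le_suminf[of g "{n}"] by simp
  have pw: "ennreal (exp (\<kappa> * X \<omega>)) \<le> 1 + (\<Sum>n. ennreal (exp (\<kappa> * real (Suc n))) * indicator (?A n) \<omega>)"
    if "\<omega> \<in> space M" for \<omega>
  proof (cases "0 < X \<omega>")
    case False
    then have "exp (\<kappa> * X \<omega>) \<le> 1" using \<kappa> by (simp add: mult_nonneg_nonpos)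
    then have "ennreal (exp (\<kappa> * X \<omega>)) \<le> 1" by (simp add: ennreal_le_1)
    then show ?thesis by (rule order_trans) simp
  next
    case True
    \<comment> \<open>The largest integer strictly below \<open>X \<omega>\<close>; the floor would
      fail at integer values, since \<open>?A n\<close> asks for strict inequality.\<close>
    define n where "n = nat (\<lceil>X \<omega>\<rceil> - 1)"
    have "int n = \<lceil>X \<omega>\<rceil> - 1" unfolding n_def using True by simp
    then have n: "real n < X \<omega>" "X \<omega> \<le> real (Suc n)" by linarith+
    have "ennreal (exp (\<kappa> * X \<omega>)) \<le> ennreal (exp (\<kappa> * real (Suc n))) * indicator (?A n) \<omega>"
      using n \<kappa> that by (simp add: ennreal_leI)
    also have "\<dots> \<le> (\<Sum>n. ennreal (exp (\<kappa> * real (Suc n))) * indicator (?A n) \<omega>)"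
      by (rule le)
    finally show ?thesis by (rule order_trans) simp
  qed
  have "(\<integral>\<^sup>+\<omega>. ennreal (norm (exp (\<kappa> * X \<omega>))) \<partial>M)
      \<le> (\<integral>\<^sup>+\<omega>. 1 + (\<Sum>n. ennreal (exp (\<kappa> * real (Suc n))) * indicator (?A n) \<omega>) \<partial>M)"
    using pw by (intro nn_integral_mono) simp
  also have "\<dots> = 1 + (\<Sum>n. ennreal (exp (\<kappa> * real (Suc n))) * emeasure M (?A n))"
    by (simp add: nn_integral_add nn_integral_suminf nn_integral_cmult emeasure_space_1)
  also have "\<dots> \<le> 1 + (\<Sum>n. ennreal (D * exp \<kappa> * exp (\<kappa> - \<gamma>) ^ n))"
  proof (intro add_left_mono suminf_le)
    fix n
    have "ennreal (exp (\<kappa> * real (Suc n))) * emeasure M (?A n)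
        \<le> ennreal (exp (\<kappa> * real (Suc n))) * ennreal (D * exp (- \<gamma> * real n))"
      unfolding emeasure_eq_measure using tail[of "real n"] by (intro mult_left_mono ennreal_leI) auto
    also have "\<dots> = ennreal (D * exp \<kappa> * exp (\<kappa> - \<gamma>) ^ n)"
      using D by (simp add: ennreal_mult[symmetric] exp_of_nat_mult[symmetric] mult_exp_exp algebra_simps)
    finally show "ennreal (exp (\<kappa> * real (Suc n))) * emeasure M (?A n)
        \<le> ennreal (D * exp \<kappa> * exp (\<kappa> - \<gamma>) ^ n)" .
  qed auto
  also have "\<dots> < \<infinity>"
    using D \<kappa> by (subst suminf_ennreal2) (auto intro!: summable_mult summable_geometric)
  finally show "(\<integral>\<^sup>+\<omega>. ennreal (norm (exp (\<kappa> * X \<omega>))) \<partial>M) < \<infinity>" .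
qed simp

text \<open>Exponential tilting: the integrand is a constant times the exponential density with rate
  \<open>\<beta> + \<gamma>\<close>, which integrates to one.\<close>

lemma exponential_laplace_transform:
  assumes T: "distributed M lborel T (exponential_density \<beta>)" and \<beta>: "0 < \<beta>" and \<gamma>: "0 \<le> \<gamma>"
  shows "(\<integral>\<^sup>+\<omega>. ennreal (exp (- \<gamma> * T \<omega>)) \<partial>M) = ennreal (\<beta> / (\<beta> + \<gamma>))"
proof -
  interpret E: prob_space "density lborel (exponential_density (\<beta> + \<gamma>))"
    using \<beta> \<gamma> by (intro prob_space_exponential_density) simp
  have "(\<integral>\<^sup>+\<omega>. ennreal (exp (- \<gamma> * T \<omega>)) \<partial>M)
      = (\<integral>\<^sup>+x. ennreal (exponential_density \<beta> x) * ennreal (exp (- \<gamma> * x)) \<partial>lborel)"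
    by (rule distributed_nn_integral[OF T, symmetric]) measurable
  also have "\<dots> = (\<integral>\<^sup>+x. ennreal (\<beta> / (\<beta> + \<gamma>)) * ennreal (exponential_density (\<beta> + \<gamma>) x) \<partial>lborel)"
  proof (rule nn_integral_cong)
    fix x :: real
    have "\<beta> * exp (- x * \<beta>) * exp (- \<gamma> * x) = \<beta> / (\<beta> + \<gamma>) * ((\<beta> + \<gamma>) * exp (- x * (\<beta> + \<gamma>)))"
      using \<beta> \<gamma> by (simp add: mult_exp_exp distrib_left mult.commute)
    then show "ennreal (exponential_density \<beta> x) * ennreal (exp (- \<gamma> * x))
        = ennreal (\<beta> / (\<beta> + \<gamma>)) * ennreal (exponential_density (\<beta> + \<gamma>) x)"
      using \<beta> \<gamma> by (simp add: exponential_density_def ennreal_mult[symmetric])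
  qed
  also have "\<dots> = ennreal (\<beta> / (\<beta> + \<gamma>)) * (\<integral>\<^sup>+x. ennreal (exponential_density (\<beta> + \<gamma>) x) \<partial>lborel)"
    by (rule nn_integral_cmult) measurable
  also have "(\<integral>\<^sup>+x. ennreal (exponential_density (\<beta> + \<gamma>) x) \<partial>lborel) = 1"
    using E.emeasure_space_1 by (simp add: emeasure_density)
  finally show ?thesis by simp
qed

lemma exp_quadratic_bound:
  fixes y :: real
  assumes "0 \<le> y"
  shows "exp y \<le> 1 + y + y\<^sup>2 * exp y"
proof -
  have "1 - y \<le> exp (- y)" using exp_ge_add_one_self[of "- y"] by simp
  then have "(1 - y) * exp y \<le> 1" by (metis exp_gt_zero exp_minus_inverse mult.commute mult_le_cancel_right_pos)
  then have 1: "exp y - 1 \<le> y * exp y" by (simp add: algebra_simps)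
  have "exp y - 1 \<le> y + y * (exp y - 1)" using 1 by (simp add: algebra_simps)
  also have "\<dots> \<le> y + y * (y * exp y)" using 1 assms by (intro add_left_mono mult_left_mono)
  finally show ?thesis by (simp add: power2_eq_square algebra_simps)
qed

text \<open>The net profit condition gives a step of the random walk negative drift, so its moment
  generating function falls below one just right of zero. An explicit quadratic remainder takes the
  place of differentiation.\<close>

lemma (in prob_space) exists_adjustment_exponent:
  fixes U :: "'a \<Rightarrow> real" and \<beta> \<kappa> :: real
  assumes U[measurable]: "random_variable borel U" and U0: "AE \<omega> in M. 0 \<le> U \<omega>"
    and intU: "integrable M U"
    and \<kappa>: "0 < \<kappa>" and int: "integrable M (\<lambda>\<omega>. exp (3 * \<kappa> * U \<omega>))"
    and \<beta>: "0 < \<beta>" and net: "\<beta> * expectation U < 1"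
  obtains \<gamma> where "0 < \<gamma>" "integrable M (\<lambda>\<omega>. exp (\<gamma> * U \<omega>))"
    "expectation (\<lambda>\<omega>. exp (\<gamma> * U \<omega>)) * (\<beta> / (\<beta> + \<gamma>)) < 1"
proof -
  \<comment> \<open>Bounds the coefficient of \<open>\<gamma>\<^sup>2\<close>: two of the three
    \<open>\<kappa>\<close> pay for the square of \<open>U\<close>, the third for the factor
    \<open>exp (\<gamma> * U \<omega>)\<close>. The added 1 makes it positive.\<close>
  define C where "C = expectation (\<lambda>\<omega>. exp (3 * \<kappa> * U \<omega>) / \<kappa>\<^sup>2) + 1"
  have C: "0 < C" unfolding C_def by (intro add_nonneg_pos integral_nonneg) auto
  define s where "s = 1 / \<beta> - expectation U"
  have s: "0 < s" using net \<beta> by (simp add: s_def field_simps)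
  \<comment> \<open>The first bound keeps the moment finite; the second keeps the quadratic term
    below the slack \<open>\<gamma> * s\<close> of the linear one.\<close>
  define \<gamma> where "\<gamma> = min \<kappa> (s / (2 * C))"
  have \<gamma>: "0 < \<gamma>" "\<gamma> \<le> \<kappa>" "\<gamma> * C < s"
  proof -
    show "0 < \<gamma>" "\<gamma> \<le> \<kappa>" using \<kappa> s C by (auto simp: \<gamma>_def)
    have "\<gamma> * C \<le> s / (2 * C) * C" using C by (intro mult_right_mono) (auto simp: \<gamma>_def)
    also have "\<dots> < s" using C s by simp
    finally show "\<gamma> * C < s" .
  qed
  have le: "AE \<omega> in M. exp (\<gamma> * U \<omega>) \<le> exp (3 * \<kappa> * U \<omega>)"
    using U0
  proof eventually_elim
    case (elim \<omega>)
    then show ?case using \<gamma> by (simp add: mult_right_mono)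
  qed
  have int\<gamma>: "integrable M (\<lambda>\<omega>. exp (\<gamma> * U \<omega>))"
    by (rule Bochner_Integration.integrable_bound[OF int]) (use le in auto)
  have "expectation (\<lambda>\<omega>. exp (\<gamma> * U \<omega>))
      \<le> expectation (\<lambda>\<omega>. 1 + \<gamma> * U \<omega> + \<gamma>\<^sup>2 * (exp (3 * \<kappa> * U \<omega>) / \<kappa>\<^sup>2))"
  proof (rule integral_mono_AE[OF int\<gamma>])
    show "AE \<omega> in M. exp (\<gamma> * U \<omega>) \<le> 1 + \<gamma> * U \<omega> + \<gamma>\<^sup>2 * (exp (3 * \<kappa> * U \<omega>) / \<kappa>\<^sup>2)"
      using U0
    proof eventually_elim
      case (elim \<omega>)
      have "\<kappa> * U \<omega> \<le> exp (\<kappa> * U \<omega>)" using exp_ge_add_one_self[of "\<kappa> * U \<omega>"] by linarith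
      then have "(\<kappa> * U \<omega>)\<^sup>2 \<le> (exp (\<kappa> * U \<omega>))\<^sup>2" using elim \<kappa> by (intro power_mono) auto
      then have sq: "(U \<omega>)\<^sup>2 \<le> exp (2 * \<kappa> * U \<omega>) / \<kappa>\<^sup>2"
        using \<kappa> by (simp add: field_simps power_mult_distrib exp_double[symmetric])
      have "(\<gamma> * U \<omega>)\<^sup>2 * exp (\<gamma> * U \<omega>) \<le> \<gamma>\<^sup>2 * (exp (2 * \<kappa> * U \<omega>) / \<kappa>\<^sup>2) * exp (\<kappa> * U \<omega>)"
        unfolding power_mult_distrib
        by (rule mult_mono[OF mult_left_mono[OF sq]]) (use elim \<gamma> in \<open>auto intro: mult_right_mono\<close>)
      also have "\<dots> = \<gamma>\<^sup>2 * (exp (3 * \<kappa> * U \<omega>) / \<kappa>\<^sup>2)"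
        by (simp add: exp_add[symmetric])
      finally show ?case using exp_quadratic_bound[of "\<gamma> * U \<omega>"] elim \<gamma> by simp
    qed
  qed (use int intU in auto)
  also have "\<dots> = 1 + \<gamma> * expectation U + \<gamma>\<^sup>2 * (C - 1)"
    using int intU by (simp add: C_def prob_space)
  also have "\<dots> < 1 + \<gamma> * expectation U + \<gamma>\<^sup>2 * C" using \<gamma> by simp
  also have "\<dots> \<le> 1 + \<gamma> * expectation U + \<gamma> * s"
    using \<gamma> by (simp add: power2_eq_square mult.assoc)
  also have "\<dots> = (\<beta> + \<gamma>) / \<beta>" using \<beta> by (simp add: s_def field_simps)
  finally have "expectation (\<lambda>\<omega>. exp (\<gamma> * U \<omega>)) * (\<beta> / (\<beta> + \<gamma>)) < 1"
    using \<beta> \<gamma> by (simp add: field_simps)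
  with that \<gamma>(1) int\<gamma> show thesis by blast
qed

section \<open>The claim surplus and its embedded random walk\<close>

context
  fixes R :: "'r measure" and \<beta> :: real and F :: "real \<Rightarrow> real" and T U :: "nat \<Rightarrow> 'r \<Rightarrow> real"
  assumes model: "compound_poisson_model R \<beta> F T U"
begin

interpretation R: prob_space R
  using model unfolding compound_poisson_model_def by auto

lemma model_indep: "R.indep_vars (\<lambda>_. borel) (case_sum T U) UNIV"
  and model_exponential: "distributed R lborel (T k) (exponential_density \<beta>)"
  and model_claim: "cdf (distr R borel (U k)) = F"
  using model unfolding compound_poisson_model_def by auto

lemma model_measurable: "T k \<in> borel_measurable R" "U k \<in> borel_measurable R"
proof -
  have "case_sum T U i \<in> borel_measurable R" for i
    using model_indep unfolding R.indep_vars_def by auto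
  from this[of "Inl k"] this[of "Inr k"] show "T k \<in> borel_measurable R" "U k \<in> borel_measurable R"
    by auto
qed

lemma claim_surplus_measurable: "claim_surplus T U t \<in> borel_measurable R"
proof -
  note [measurable] = model_measurable
  have [measurable]: "arrival_time T k \<in> borel_measurable R" for k
    unfolding arrival_time_def by measurable
  show ?thesis unfolding claim_surplus_def by measurable
qed

text \<open>Claims only accumulate, so the surplus just after a time is at worst slightly smaller and
  rational times suffice.\<close>

lemma max_surplus_gt_iff:
  "ereal u < max_surplus T U \<omega> \<longleftrightarrow> (\<exists>q\<in>{0..} \<inter> \<rat>. ereal u < claim_surplus T U q \<omega>)"
proof
  assume "ereal u < max_surplus T U \<omega>"
  then obtain t where t: "0 \<le> t" "ereal u < claim_surplus T U t \<omega>"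
    unfolding max_surplus_def less_SUP_iff by auto
  define N where "N t = enn2ereal (\<Sum>k. ennreal (U k \<omega>) * indicator {..t} (arrival_time T k \<omega>))" for t
  have "ereal (u + t) < N t"
    using t(2) unfolding claim_surplus_def N_def[symmetric] by (cases "N t") auto
  then obtain y where y: "u + t < y" "ereal y < N t"
    using ereal_dense2 by (metis less_ereal.simps(1))
  obtain q where q: "q \<in> \<rat>" "t < q" "q < y - u"
    using Rats_dense_in_real[of t "y - u"] y(1) by auto
  have "N t \<le> N q" unfolding N_def less_eq_ennreal.rep_eq[symmetric]
    using q(2) by (intro suminf_le mult_left_mono) (auto simp: indicator_def)
  then have "ereal y < N q" using y(2) by order
  then have "ereal u < claim_surplus T U q \<omega>"
    unfolding claim_surplus_def N_def[symmetric] using q by (cases "N q") auto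
  then show "\<exists>q\<in>{0..} \<inter> \<rat>. ereal u < claim_surplus T U q \<omega>" using q t by auto
next
  assume "\<exists>q\<in>{0..} \<inter> \<rat>. ereal u < claim_surplus T U q \<omega>"
  then show "ereal u < max_surplus T U \<omega>" unfolding max_surplus_def less_SUP_iff by auto
qed

lemma max_surplus_event: "{\<omega> \<in> space R. ereal u < max_surplus T U \<omega>} \<in> sets R"
proof -
  have "{\<omega> \<in> space R. ereal u < max_surplus T U \<omega>} =
      (\<Union>q\<in>{0..} \<inter> \<rat>. {\<omega> \<in> space R. ereal u < claim_surplus T U q \<omega>})"
    unfolding max_surplus_gt_iff by auto
  also have "\<dots> \<in> sets R"
    supply [measurable] = claim_surplus_measurable
    by (intro sets.countable_UN'' countable_Int2 countable_rat) measurable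
  finally show ?thesis .
qed

lemma max_surplus_nonneg: "0 \<le> max_surplus T U \<omega>"
proof -
  have "0 \<le> claim_surplus T U 0 \<omega>" unfolding claim_surplus_def by (simp add: zero_ereal_def[symmetric])
  also have "\<dots> \<le> max_surplus T U \<omega>" unfolding max_surplus_def by (rule SUP_upper) simp
  finally show ?thesis .
qed

lemma ruin_prob_eq: "ruin_prob R T U u = 1 - measure R {\<omega> \<in> space R. max_surplus T U \<omega> \<le> ereal u}"
proof -
  have "{\<omega> \<in> space R. max_surplus T U \<omega> \<le> ereal u} = space R - {\<omega> \<in> space R. ereal u < max_surplus T U \<omega>}"
    by (auto simp: not_less)
  then show ?thesis unfolding ruin_prob_def using R.prob_compl[OF max_surplus_event] by simp
qed

text \<open>Between claims the surplus only falls, so a level exceeded at some time is already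
  exceeded at the latest claim arrival before it.\<close>

lemma surplus_exceeds_random_walk:
  assumes U: "\<And>k. 0 \<le> U k \<omega>" and u: "0 \<le> u"
    and gt: "ereal u < max_surplus T U \<omega>"
  shows "\<exists>m. u < (\<Sum>k\<le>m. U k \<omega> - T k \<omega>)"
proof -
  obtain t where t: "0 \<le> t" "ereal u < claim_surplus T U t \<omega>"
    using gt unfolding max_surplus_gt_iff by auto
  let ?c = "\<lambda>k. U k \<omega> * indicator {..t} (arrival_time T k \<omega>)"
  have c: "ennreal (U k \<omega>) * indicator {..t} (arrival_time T k \<omega>) = ennreal (?c k)" for k
    by (auto simp: indicator_def)
  have "ereal (u + t) < enn2ereal (\<Sum>k. ennreal (?c k))"
    using t(2) unfolding claim_surplus_def c
    by (cases "enn2ereal (\<Sum>k. ennreal (?c k))") auto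
  then have "ennreal (u + t) < (\<Sum>k. ennreal (?c k))"
    using u t(1) by (subst less_ennreal.rep_eq) (simp add: enn2ereal_ennreal del: ennreal_plus)
  \<comment> \<open>The series is the supremum of its partial sums, so finitely many claims already
    exceed \<open>u + t\<close>.\<close>
  then obtain m where m: "ennreal (u + t) < (\<Sum>k<m. ennreal (?c k))"
    unfolding suminf_eq_SUP less_SUP_iff by auto
  have "(\<Sum>k<m. ennreal (?c k)) = ennreal (\<Sum>k<m. ?c k)"
    using U by (intro sum_ennreal) (auto simp: indicator_def)
  with m u t(1) have m: "u + t < (\<Sum>k<m. ?c k)"
    by (simp add: ennreal_less_iff del: ennreal_plus)
  define J where "J = {k\<in>{..<m}. arrival_time T k \<omega> \<le> t}"
  have sumJ: "(\<Sum>k<m. ?c k) = (\<Sum>k\<in>J. U k \<omega>)"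
    unfolding J_def sum.inter_filter[OF finite_lessThan] by (rule sum.cong) auto
  have "J \<noteq> {}" using m u t(1) unfolding sumJ by auto
  \<comment> \<open>Where interarrival times are negative, \<open>J\<close> may have gaps below its
    maximum; filling them adds nonnegative claims and only increases the sum.\<close>
  define j where "j = Max J"
  have fin: "finite J" by (simp add: J_def)
  have j: "j \<in> J" "\<And>k. k \<in> J \<Longrightarrow> k \<le> j"
    unfolding j_def using \<open>J \<noteq> {}\<close> fin by auto
  have "(\<Sum>k\<in>J. U k \<omega>) \<le> (\<Sum>k\<le>j. U k \<omega>)"
    using j(2) U by (intro sum_mono2) auto
  moreover have "(\<Sum>k\<le>j. T k \<omega>) \<le> t" using j(1) by (simp add: J_def arrival_time_def)
  ultimately have "u < (\<Sum>k\<le>j. U k \<omega> - T k \<omega>)" using m unfolding sumJ by (simp add: sum_subtractf)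
  then show ?thesis ..
qed

lemma random_walk_mgf:
  assumes \<beta>: "0 < \<beta>" and \<gamma>: "0 \<le> \<gamma>" and m: "0 \<le> m"
    and U: "\<And>k. (\<integral>\<^sup>+\<omega>. ennreal (exp (\<gamma> * U k \<omega>)) \<partial>R) = ennreal m"
  shows "(\<integral>\<^sup>+\<omega>. ennreal (exp (\<gamma> * (\<Sum>k\<le>n. U k \<omega> - T k \<omega>))) \<partial>R)
           = ennreal ((m * (\<beta> / (\<beta> + \<gamma>))) ^ Suc n)"
proof -
  note [measurable] = model_measurable
  \<comment> \<open>The signed exponents turn interarrival times and claims into one jointly
    independent family \<open>V\<close>, whose product is the exponential of the walk.\<close>
  define c :: "nat + nat \<Rightarrow> real" where "c = case_sum (\<lambda>_. - \<gamma>) (\<lambda>_. \<gamma>)"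
  define V where "V i \<omega> = ennreal (exp (c i * case_sum T U i \<omega>))" for i \<omega>
  let ?I = "{..n} <+> {..n}"
  have "R.indep_vars (\<lambda>_. borel) V UNIV"
    unfolding V_def by (rule R.indep_vars_compose2[OF model_indep]) measurable
  then have ind: "R.indep_vars (\<lambda>_. borel) V ?I" by (rule R.indep_vars_subset) simp
  have "ennreal (exp (\<gamma> * (\<Sum>k\<le>n. U k \<omega> - T k \<omega>))) = (\<Prod>i\<in>?I. V i \<omega>)" for \<omega>
  proof -
    have "(\<Prod>i\<in>?I. V i \<omega>) = ennreal (\<Prod>i\<in>?I. exp (c i * case_sum T U i \<omega>))"
      unfolding V_def by (rule prod_ennreal) simp
    also have "(\<Prod>i\<in>?I. exp (c i * case_sum T U i \<omega>))
        = exp (\<Sum>k\<le>n. - (\<gamma> * T k \<omega>)) * exp (\<Sum>k\<le>n. \<gamma> * U k \<omega>)"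
      by (simp add: prod.Plus c_def exp_sum)
    also have "\<dots> = exp (\<gamma> * (\<Sum>k\<le>n. U k \<omega> - T k \<omega>))"
      unfolding mult_exp_exp
      by (simp add: sum_subtractf sum_negf right_diff_distrib sum_distrib_left)
    finally show ?thesis ..
  qed
  then have "(\<integral>\<^sup>+\<omega>. ennreal (exp (\<gamma> * (\<Sum>k\<le>n. U k \<omega> - T k \<omega>))) \<partial>R)
      = (\<integral>\<^sup>+\<omega>. (\<Prod>i\<in>?I. V i \<omega>) \<partial>R)" by simp
  also have "\<dots> = (\<Prod>i\<in>?I. \<integral>\<^sup>+\<omega>. V i \<omega> \<partial>R)"
    by (rule R.indep_vars_nn_integral[OF _ ind]) auto
  also have "\<dots> = (\<Prod>k\<le>n. \<integral>\<^sup>+\<omega>. ennreal (exp (- \<gamma> * T k \<omega>)) \<partial>R)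
      * (\<Prod>k\<le>n. \<integral>\<^sup>+\<omega>. ennreal (exp (\<gamma> * U k \<omega>)) \<partial>R)"
    by (simp add: prod.Plus V_def c_def)
  also have "\<dots> = ennreal (\<beta> / (\<beta> + \<gamma>)) ^ Suc n * ennreal m ^ Suc n"
    by (simp only: U exponential_laplace_transform[OF model_exponential \<beta> \<gamma>] prod_constant card_atMost)
  also have "\<dots> = ennreal ((m * (\<beta> / (\<beta> + \<gamma>))) ^ Suc n)"
    using \<beta> \<gamma> m by (simp only: ennreal_power ennreal_mult[symmetric] divide_nonneg_pos zero_le_power
        power_mult_distrib add_pos_nonneg less_imp_le mult.commute)
  finally show ?thesis .
qed

lemma ruin_prob_exponential_bound:
  assumes \<beta>: "0 < \<beta>" and \<gamma>: "0 < \<gamma>" and m: "0 \<le> m" "m * (\<beta> / (\<beta> + \<gamma>)) < 1"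
    and U: "\<And>k. (\<integral>\<^sup>+\<omega>. ennreal (exp (\<gamma> * U k \<omega>)) \<partial>R) = ennreal m"
    and neg: "\<And>x. x < 0 \<Longrightarrow> F x = 0" and u: "0 \<le> u"
  shows "ruin_prob R T U u \<le> 1 / (1 - m * (\<beta> / (\<beta> + \<gamma>))) * exp (- \<gamma> * u)"
proof -
  note [measurable] = model_measurable
  define r where "r = m * (\<beta> / (\<beta> + \<gamma>))"
  have r: "0 \<le> r" "r < 1" using m \<beta> \<gamma> by (auto simp: r_def)
  let ?S = "\<lambda>n \<omega>. \<Sum>k\<le>n. U k \<omega> - T k \<omega>"
  let ?A = "\<lambda>n. {\<omega> \<in> space R. u < ?S n \<omega>}"
  have U0: "AE \<omega> in R. 0 \<le> U k \<omega>" for k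
  proof -
    interpret D: real_distribution "distr R borel (U k)"
      by (rule R.real_distribution_distr) measurable
    have "AE x in distr R borel (U k). 0 \<le> x"
      by (rule D.AE_nonneg_of_cdf) (simp add: model_claim neg)
    then show ?thesis by (subst (asm) AE_distr_iff) auto
  qed
  have step: "emeasure R (?A n) \<le> ennreal (exp (- \<gamma> * u) * r ^ Suc n)" for n
  proof -
    have "emeasure R (?A n) = (\<integral>\<^sup>+\<omega>. indicator (?A n) \<omega> \<partial>R)" by simp
    also have "\<dots> \<le> (\<integral>\<^sup>+\<omega>. ennreal (exp (- \<gamma> * u)) * ennreal (exp (\<gamma> * ?S n \<omega>)) \<partial>R)"
    proof (rule nn_integral_mono)
      fix \<omega>
      show "indicator (?A n) \<omega> \<le> ennreal (exp (- \<gamma> * u)) * ennreal (exp (\<gamma> * ?S n \<omega>))"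
      proof (cases "\<omega> \<in> ?A n")
        case True
        then have "\<gamma> * u \<le> \<gamma> * ?S n \<omega>" using \<gamma> by (intro mult_left_mono) auto
        then have "1 \<le> exp (- \<gamma> * u) * exp (\<gamma> * ?S n \<omega>)"
          unfolding mult_exp_exp by simp
        then have "ennreal 1 \<le> ennreal (exp (- \<gamma> * u) * exp (\<gamma> * ?S n \<omega>))" by (rule ennreal_leI)
        then show ?thesis using True by (simp add: ennreal_mult)
      qed simp
    qed
    also have "\<dots> = ennreal (exp (- \<gamma> * u)) * ennreal (r ^ Suc n)"
      using random_walk_mgf[OF \<beta> less_imp_le[OF \<gamma>] m(1) U, of n]
      by (subst nn_integral_cmult) (auto simp: r_def)
    finally show ?thesis using r by (simp add: ennreal_mult)
  qed
  \<comment> \<open>The comparison with the walk requires nonnegative claims, hence the inclusion is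
    claimed almost everywhere only.\<close>
  have "emeasure R {\<omega> \<in> space R. ereal u < max_surplus T U \<omega>} \<le> emeasure R (\<Union>n. ?A n)"
  proof (rule emeasure_mono_AE)
    have "AE \<omega> in R. \<forall>k. 0 \<le> U k \<omega>"
      using U0 by (simp add: AE_all_countable)
    then show "AE \<omega> in R. \<omega> \<in> {\<omega> \<in> space R. ereal u < max_surplus T U \<omega>} \<longrightarrow> \<omega> \<in> (\<Union>n. ?A n)"
    proof eventually_elim
      case (elim \<omega>)
      then show ?case using surplus_exceeds_random_walk[of \<omega> u] u by auto
    qed
  qed measurable
  also have "\<dots> \<le> (\<Sum>n. emeasure R (?A n))"
    by (rule emeasure_subadditive_countably) auto
  also have "\<dots> \<le> (\<Sum>n. ennreal (exp (- \<gamma> * u) * r * r ^ n))"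
    using step by (intro suminf_le) (auto simp: mult.assoc)
  also have "\<dots> = ennreal (\<Sum>n. exp (- \<gamma> * u) * r * r ^ n)"
    using r by (intro suminf_ennreal2) (auto intro!: summable_mult summable_geometric)
  also have "(\<Sum>n. exp (- \<gamma> * u) * r * r ^ n) = exp (- \<gamma> * u) * r * (1 / (1 - r))"
    using r by (simp add: suminf_mult suminf_geometric)
  also have "\<dots> \<le> 1 / (1 - r) * exp (- \<gamma> * u)"
    using r by (simp add: mult.assoc mult.commute[of r] divide_right_mono mult_left_le)
  finally have "emeasure R {\<omega> \<in> space R. ereal u < max_surplus T U \<omega>}
      \<le> ennreal (1 / (1 - r) * exp (- \<gamma> * u))" by (simp add: ennreal_leI)
  then show ?thesis
    using r unfolding ruin_prob_def r_def[symmetric]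
    by (simp add: R.emeasure_eq_measure ennreal_le_iff)
qed

end

lemma phase_type_ruin_prob_exponential_bound:
  fixes P :: "'s::finite \<Rightarrow> 'p measure" and B :: "'w \<Rightarrow> real"
  assumes ph: "phase_type_df P X a \<alpha> F"
    and \<Omega>: "prob_space \<Omega>" and B: "B \<in> borel_measurable \<Omega>" "cdf (distr \<Omega> borel B) = F" "integrable \<Omega> B"
    and model: "compound_poisson_model R \<beta> F T U" and \<beta>: "0 < \<beta>"
    and net: "\<beta> * (\<integral>\<omega>. B \<omega> \<partial>\<Omega>) < 1"
  obtains D \<gamma> where "0 < \<gamma>" "\<And>u. 0 \<le> u \<Longrightarrow> ruin_prob R T U u \<le> D * exp (- \<gamma> * u)"
proof -
  interpret prob_space \<Omega> by fact
  interpret R: prob_space R using model unfolding compound_poisson_model_def by auto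
  note [measurable] = B(1)
  have [measurable]: "U k \<in> borel_measurable R" for k by (rule model_measurable[OF model])
  interpret DB: real_distribution "distr \<Omega> borel B" by (rule real_distribution_distr) measurable
  have neg: "F x = 0" if "x < 0" for x by (rule phase_type_df_negative[OF ph that])
  obtain D \<gamma>0 where \<gamma>0: "0 < \<gamma>0" and tail: "\<And>u. 0 \<le> u \<Longrightarrow> 1 - F u \<le> D * exp (- \<gamma>0 * u)"
    using phase_type_df_exponential_tail[OF ph] by metis
  have B0: "AE \<omega> in \<Omega>. 0 \<le> B \<omega>"
  proof -
    have "AE x in distr \<Omega> borel B. 0 \<le> x" by (rule DB.AE_nonneg_of_cdf) (simp add: B(2) neg)
    then show ?thesis by (subst (asm) AE_distr_iff) auto
  qed
  have "prob {\<omega> \<in> space \<Omega>. u < B \<omega>} = 1 - F u" for u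
    using DB.tail_eq_cdf[of u] by (simp add: B(2) measure_distr vimage_def Int_def conj_commute)
  \<comment> \<open>The exponent is \<open>\<gamma>0 / 2\<close>, inside the range allowed by the
    tail, written in the form \<open>3 * \<kappa>\<close> that
    \<open>exists_adjustment_exponent\<close> expects.\<close>
  then have "integrable \<Omega> (\<lambda>\<omega>. exp (3 * (\<gamma>0 / 6) * B \<omega>))"
    using integrable_exp_of_exponential_tail[of B D \<gamma>0 "\<gamma>0 / 2"] tail \<gamma>0 by simp
  then obtain \<gamma> where \<gamma>: "0 < \<gamma>" and int: "integrable \<Omega> (\<lambda>\<omega>. exp (\<gamma> * B \<omega>))"
    and r: "expectation (\<lambda>\<omega>. exp (\<gamma> * B \<omega>)) * (\<beta> / (\<beta> + \<gamma>)) < 1"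
    using exists_adjustment_exponent[OF B(1) B0 B(3), of "\<gamma>0 / 6" \<beta>] \<gamma>0 \<beta> net by auto
  define m where "m = expectation (\<lambda>\<omega>. exp (\<gamma> * B \<omega>))"
  have m: "0 \<le> m" unfolding m_def by (rule Bochner_Integration.integral_nonneg) simp
  have "(\<integral>\<^sup>+\<omega>. ennreal (exp (\<gamma> * U k \<omega>)) \<partial>R) = ennreal m" for k
  proof -
    \<comment> \<open>A law on the line is determined by its distribution function, so the moments
      of \<open>B\<close> carry over to the claims on \<open>R\<close>.\<close>
    have eq: "distr R borel (U k) = distr \<Omega> borel B"
      using model_claim[OF model] B(2)
      by (intro cdf_unique R.real_distribution_distr DB.real_distribution_axioms) auto
    have "(\<integral>\<^sup>+\<omega>. ennreal (exp (\<gamma> * U k \<omega>)) \<partial>R) = (\<integral>\<^sup>+x. ennreal (exp (\<gamma> * x)) \<partial>distr R borel (U k))"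
      by (rule nn_integral_distr[symmetric]) measurable
    also have "\<dots> = (\<integral>\<^sup>+\<omega>. ennreal (exp (\<gamma> * B \<omega>)) \<partial>\<Omega>)"
      unfolding eq by (rule nn_integral_distr) measurable
    also have "\<dots> = ennreal m"
      unfolding m_def by (rule nn_integral_eq_integral[OF int]) simp
    finally show ?thesis .
  qed
  from ruin_prob_exponential_bound[OF model \<beta> \<gamma> m r[folded m_def] this neg]
  show thesis using that[OF \<gamma>] by blast
qed


section \<open>The asymptotics of the approximation\<close>

lemma (in prob_space) prob_Max_greater:
  fixes Y :: "'i \<Rightarrow> 'a \<Rightarrow> real"
  assumes indep: "indep_vars (\<lambda>_. borel) Y I" and I: "finite I" "I \<noteq> {}"
    and F: "\<And>i. i \<in> I \<Longrightarrow> cdf (distr M borel (Y i)) = F"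
  shows "prob {\<omega> \<in> space M. u < Max ((\<lambda>i. Y i \<omega>) ` I)} = 1 - F u ^ card I"
proof -
  have rv: "random_variable borel (Y i)" if "i \<in> I" for i
    using indep that unfolding indep_vars_def by auto
  let ?E = "\<Inter>i\<in>I. Y i -` {..u} \<inter> space M"
  have "?E \<in> events" using I rv by (intro sets.finite_INT) (auto intro: measurable_sets)
  have "prob ?E = (\<Prod>i\<in>I. prob (Y i -` {..u} \<inter> space M))"
    by (rule indep_varsD[OF indep]) (use I in auto)
  also have "\<dots> = (\<Prod>i\<in>I. F u)"
  proof (rule prod.cong[OF refl])
    fix i assume i: "i \<in> I"
    show "prob (Y i -` {..u} \<inter> space M) = F u"
      using measure_distr[OF rv[OF i], of "{..u}"] fun_cong[OF F[OF i], of u] by (simp add: cdf_def)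
  qed
  finally have "prob ?E = F u ^ card I" by simp
  moreover have "{\<omega> \<in> space M. u < Max ((\<lambda>i. Y i \<omega>) ` I)} = space M - ?E"
    using I by (auto simp: Max_gr_iff not_le)
  ultimately show ?thesis using prob_compl[OF \<open>?E \<in> events\<close>] by simp
qed

text \<open>Converts the limit into the closed form of the theorem; the factor
  \<open>(1 - q)\<^sup>2\<close> keeps the induction free of division.\<close>

lemma sum_index_times_power:
  fixes q :: real
  shows "(1 - q)\<^sup>2 * (\<Sum>k=1..n. real k * q ^ k) = q * (1 - (real n + 1) * q ^ n + real n * q ^ (n + 1))"
  by (induction n) (simp_all add: algebra_simps power2_eq_square)

theorem proposition3p3:
  fixes lam \<epsilon> \<mu>B \<mu>C \<delta> \<theta> \<rho>b \<rho> :: real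
    and F_p F_h :: "real \<Rightarrow> real"
    and P :: "'s::finite \<Rightarrow> 'p measure" and X :: "real \<Rightarrow> 'p \<Rightarrow> 's" and a :: 's and \<alpha> :: "'s pmf"
    and Q :: "'q measure" and T' U' :: "nat \<Rightarrow> 'q \<Rightarrow> real"
    and R :: "'r measure" and T U :: "nat \<Rightarrow> 'r \<Rightarrow> real"
    and \<Omega> :: "'w measure" and B C :: "'w \<Rightarrow> real" and M Ce :: "nat \<Rightarrow> 'w \<Rightarrow> real"
    and \<phi> \<psi> :: "real \<Rightarrow> real" and n :: nat
  assumes lam: "lam > 0" and eps: "0 < \<epsilon>" "\<epsilon> < 1"
    and \<Omega>: "prob_space \<Omega>"
    \<comment> \<open>claim sizes\<close>
    and F_p: "phase_type_df P X a \<alpha> F_p"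
    and B: "B \<in> borel_measurable \<Omega>" "cdf (distr \<Omega> borel B) = F_p" "integrable \<Omega> B"
    and \<mu>B: "\<mu>B = (\<integral>\<omega>. B \<omega> \<partial>\<Omega>)"
    and F_h: "subexponential F_h"
    and C: "C \<in> borel_measurable \<Omega>" "cdf (distr \<Omega> borel C) = F_h" "integrable \<Omega> C"
    and \<mu>C: "\<mu>C = (\<integral>\<omega>. C \<omega> \<partial>\<Omega>)"
    \<comment> \<open>the mixture model\<close>
    and mixture: "compound_poisson_model Q lam (\<lambda>u. (1 - \<epsilon>) * F_p u + \<epsilon> * F_h u) T' U'"
    and \<delta>: "\<delta> = lam * \<mu>B" and \<theta>: "\<theta> = lam * \<mu>C"
    and \<rho>b: "\<rho>b = (1 - \<epsilon>) * \<delta>" and \<rho>: "\<rho> = \<rho>b + \<epsilon> * \<theta>"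
    and net_profit: "\<rho> < 1"
    \<comment> \<open>the model without heavy-tailed claims, and copies of the supremum of its claim surplus\<close>
    and bullet: "compound_poisson_model R ((1 - \<epsilon>) * lam) F_p T U"
    and M: "\<And>k u. cdf (distr \<Omega> borel (M k)) u =
                  measure R {\<omega> \<in> space R. max_surplus T U \<omega> \<le> ereal u}"
    and Ce: "\<And>k. k \<ge> 1 \<Longrightarrow> cdf (distr \<Omega> borel (Ce k)) = excess_df \<mu>C F_h"
    and indep: "prob_space.indep_vars \<Omega> (\<lambda>_. borel) (case_sum M Ce) (UNIV <+> {1..})"
    and subexp: "subexponential (excess_df \<mu>C F_h)"
    and n: "n \<ge> 1"
    and \<phi>: "\<And>u. \<phi> u = (1 - \<rho>) / (1 - \<rho>b) *
           (\<Sum>k=2..n. (\<epsilon> * \<theta> / (1 - \<rho>b)) ^ k *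
              measure \<Omega> {\<omega> \<in> space \<Omega>. Max ((\<lambda>i. Ce i \<omega>) ` {1..k}) > u})"
    and \<psi>: "\<And>u. \<psi> u = (1 - \<rho>) / (1 - \<rho>b) * ruin_prob R T U u +
           (1 - \<rho>) / (1 - \<rho>b) * (\<epsilon> * \<theta> / (1 - \<rho>b)) *
              measure \<Omega> {\<omega> \<in> space \<Omega>. M 0 \<omega> + M 1 \<omega> + Ce 1 \<omega> > u} +
           \<phi> u"
  shows "\<psi> \<sim>[at_top]
    (\<lambda>u. \<epsilon> * \<theta> / (1 - \<rho>) *
         (1 - (real n + 1) * (\<epsilon> * \<theta> / (1 - \<rho>b)) ^ n + real n * (\<epsilon> * \<theta> / (1 - \<rho>b)) ^ (n + 1)) *
         (1 - excess_df \<mu>C F_h u))"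
proof -
  interpret prob_space \<Omega> by fact
  define F where "F = excess_df \<mu>C F_h"
  define h where "h u = 1 - F u" for u
  define q where "q = \<epsilon> * \<theta> / (1 - \<rho>b)"
  have df: "distribution_function_nonneg F" and pos: "\<And>u. 0 < h u"
    using subexp unfolding subexponential_def F_def[symmetric] h_def by auto
  have lim1: "(F \<longlongrightarrow> 1) at_top"
    using df unfolding distribution_function_nonneg_def by auto
  have long: "((\<lambda>u. h (u - y) / h u) \<longlongrightarrow> 1) at_top" if "0 \<le> y" for y
    unfolding h_def by (rule subexponential_long_tailed[OF subexp[folded F_def] that])

  have rv: "random_variable borel (case_sum M Ce i)" if "i \<in> UNIV <+> {1..}" for i
    using indep that unfolding indep_vars_def by blast
  have rvM [measurable]: "random_variable borel (M k)" for k using rv[of "Inl k"] by auto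
  have rvC [measurable]: "random_variable borel (Ce 1)" using rv[of "Inr 1"] by auto
  define N where "N = distr \<Omega> borel (Ce 1)"
  have N: "real_distribution N" unfolding N_def by (rule real_distribution_distr) measurable
  interpret N: real_distribution N by fact
  have cdfN: "cdf N = F" unfolding N_def F_def by (rule Ce) simp
  have h1: "h u \<le> 1" for u using N.cdf_nonneg[of u] by (simp add: h_def cdfN)
  have anti: "h t \<le> h s" if "s \<le> t" for s t
    using N.cdf_nondecreasing[OF that] by (simp add: h_def cdfN)

  \<comment> \<open>A nonnegative variable with mean zero vanishes almost surely, against the
    positive tail of \<open>F_h\<close> at 0. Positivity of \<open>q\<close>, and finally of
    \<open>c\<close>, depends on this.\<close>
  have "0 < \<mu>C"
  proof -
    interpret DC: real_distribution "distr \<Omega> borel C" by (rule real_distribution_distr) (rule C(1))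
    have "AE x in distr \<Omega> borel C. 0 \<le> x"
      by (rule DC.AE_nonneg_of_cdf)
         (use F_h in \<open>auto simp: C(2) subexponential_def distribution_function_nonneg_def\<close>)
    then have C0: "AE \<omega> in \<Omega>. 0 \<le> C \<omega>" using C(1) by (subst (asm) AE_distr_iff) auto
    have "\<mu>C \<noteq> 0"
    proof
      assume "\<mu>C = 0"
      then have "AE \<omega> in \<Omega>. C \<omega> = 0"
        using integral_nonneg_eq_0_iff_AE[OF C(3) C0] \<mu>C by simp
      then have "prob (C -` {0<..} \<inter> space \<Omega>) = 0"
        using C(1) by (subst prob_eq_0) (auto intro: measurable_sets elim: eventually_mono)
      then have "measure (distr \<Omega> borel C) {0<..} = 0" using C(1) by (simp add: measure_distr)
      moreover have "F_h 0 < 1" using F_h by (simp add: subexponential_def)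
      ultimately show False by (simp add: DC.tail_eq_cdf C(2))
    qed
    then show ?thesis using integral_nonneg_AE[OF C0] \<mu>C by simp
  qed
  then have \<theta>0: "0 < \<epsilon> * \<theta>" using lam eps by (simp add: \<theta>)
  then have \<rho>b1: "\<rho>b < 1" using net_profit by (simp add: \<rho>)
  have q: "0 < q" "q < 1" using \<theta>0 \<rho>b1 net_profit by (auto simp: q_def \<rho>)
  have q1: "(1 - \<rho>) / (1 - \<rho>b) = 1 - q" using \<rho>b1 by (simp add: q_def \<rho> field_simps)

  \<comment> \<open>The ruin probability of the phase-type model is negligible\<close>
  have "0 < (1 - \<epsilon>) * lam" "(1 - \<epsilon>) * lam * (\<integral>\<omega>. B \<omega> \<partial>\<Omega>) < 1"
    using \<rho>b1 lam eps by (simp_all add: \<rho>b \<delta> \<mu>B mult.assoc)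
  from phase_type_ruin_prob_exponential_bound[OF F_p \<Omega> B bullet this] obtain D \<gamma> where \<gamma>: "0 < \<gamma>"
    and ruin: "\<And>u. 0 \<le> u \<Longrightarrow> ruin_prob R T U u \<le> D * exp (- \<gamma> * u)"
    by metis
  have exp_h: "((\<lambda>u. exp (- \<gamma> * u) / h u) \<longlongrightarrow> 0) at_top"
    by (rule exponential_negligible_long_tailed[OF pos h1 anti long[OF zero_le_one] \<gamma>])

  have lim_ruin: "((\<lambda>u. ruin_prob R T U u / h u) \<longlongrightarrow> 0) at_top"
  proof (rule tendsto_sandwich[OF _ _ tendsto_const tendsto_mult_right_zero[OF exp_h, of D]])
    show "\<forall>\<^sub>F u in at_top. 0 \<le> ruin_prob R T U u / h u"
      by (intro always_eventually allI divide_nonneg_pos pos) (simp add: ruin_prob_def)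
    show "\<forall>\<^sub>F u in at_top. ruin_prob R T U u / h u \<le> D * (exp (- \<gamma> * u) / h u)"
      using eventually_ge_at_top[of 0]
    proof eventually_elim
      case (elim u)
      then show ?case using divide_right_mono[OF ruin[OF elim] less_imp_le[OF pos[of u]]] by simp
    qed
  qed

  \<comment> \<open>The light-tailed summand and the term with one heavy claim\<close>
  define S where "S \<omega> = M 0 \<omega> + M 1 \<omega>" for \<omega>
  have [measurable]: "random_variable borel S" unfolding S_def by measurable
  define L where "L = distr \<Omega> borel S"
  have L: "real_distribution L" unfolding L_def by (rule real_distribution_distr) measurable
  interpret L: real_distribution L by fact
  have M0: "AE \<omega> in \<Omega>. 0 \<le> M k \<omega>" for k
  proof -
    interpret DM: real_distribution "distr \<Omega> borel (M k)" by (rule real_distribution_distr) measurable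
    have "\<not> max_surplus T U \<omega> \<le> ereal x" if "x < 0" for x \<omega>
      using that order_trans[OF max_surplus_nonneg[OF bullet, of \<omega>], of "ereal x"] by auto
    then have "AE x in distr \<Omega> borel (M k). 0 \<le> x"
      by (intro DM.AE_nonneg_of_cdf) (simp add: M)
    then show ?thesis by (subst (asm) AE_distr_iff) auto
  qed
  have L0: "AE x in L. 0 \<le> x"
    unfolding L_def S_def using M0[of 0] M0[of 1] by (subst AE_distr_iff) auto
  have tailM: "prob {\<omega> \<in> space \<Omega>. u < M k \<omega>} = ruin_prob R T U u" for k u
  proof -
    interpret DM: real_distribution "distr \<Omega> borel (M k)" by (rule real_distribution_distr) measurable
    show ?thesis using DM.tail_eq_cdf[of u] ruin_prob_eq[OF bullet]
      by (simp add: M measure_distr vimage_def Int_def conj_commute)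
  qed
  \<comment> \<open>If \<open>S\<close> exceeds \<open>u\<close>, one of its two summands exceeds
    \<open>u / 2\<close>; this halves the rate, and \<open>\<gamma> / 4\<close> lies below
    \<open>\<gamma> / 2\<close>.\<close>
  have "integrable \<Omega> (\<lambda>\<omega>. exp (\<gamma> / 4 * S \<omega>))"
  proof (rule integrable_exp_of_exponential_tail)
    fix u :: real assume u: "0 \<le> u"
    have "prob {\<omega> \<in> space \<Omega>. u < S \<omega>} \<le>
        prob ({\<omega> \<in> space \<Omega>. u / 2 < M 0 \<omega>} \<union> {\<omega> \<in> space \<Omega>. u / 2 < M 1 \<omega>})"
      by (rule finite_measure_mono) (auto simp: S_def)
    also have "\<dots> \<le> prob {\<omega> \<in> space \<Omega>. u / 2 < M 0 \<omega>} + prob {\<omega> \<in> space \<Omega>. u / 2 < M 1 \<omega>}"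
      by (rule measure_Un_le) measurable
    also have "\<dots> \<le> 2 * D * exp (- (\<gamma> / 2) * u)"
      unfolding tailM using ruin[of "u / 2"] u by simp
    finally show "prob {\<omega> \<in> space \<Omega>. u < S \<omega>} \<le> 2 * D * exp (- (\<gamma> / 2) * u)" .
  qed (use \<gamma> in auto)
  then have intL: "integrable L (\<lambda>x. exp (\<gamma> / 4 * x))"
    unfolding L_def by (subst integrable_distr_eq) auto

  \<comment> \<open>Singling out \<open>Inr 1\<close> makes \<open>Ce 1\<close> independent of the
    sum over the remaining indices, which is \<open>S\<close>.\<close>
  have "indep_vars (\<lambda>_. borel) (case_sum M Ce) (insert (Inr 1) {Inl 0, Inl 1})"
    by (rule indep_vars_subset[OF indep]) auto
  from indep_vars_sum[OF _ _ this]
  have "indep_var borel (Ce 1) borel S" by (simp add: S_def[abs_def])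
  then have "distr \<Omega> borel (\<lambda>\<omega>. Ce 1 \<omega> + S \<omega>) = (N \<star> L)"
    unfolding N_def L_def by (rule sum_indep_random_variable) measurable
  \<comment> \<open>The order is swapped so that the light law \<open>L\<close> becomes the
    integrating measure.\<close>
  also have "\<dots> = (L \<star> N)"
    by (rule convolution_commutative) (auto simp: N.finite_measure_axioms L.finite_measure_axioms)
  finally have conv: "distr \<Omega> borel (\<lambda>\<omega>. Ce 1 \<omega> + S \<omega>) = (L \<star> N)" .
  interpret LN: real_distribution "L \<star> N" by (rule real_distribution_convolution) fact+
  have tail_sum: "prob {\<omega> \<in> space \<Omega>. M 0 \<omega> + M 1 \<omega> + Ce 1 \<omega> > u} = 1 - cdf (L \<star> N) u" for u
  proof -
    have eq: "{\<omega> \<in> space \<Omega>. M 0 \<omega> + M 1 \<omega> + Ce 1 \<omega> > u} = (\<lambda>\<omega>. Ce 1 \<omega> + S \<omega>) -` {u<..} \<inter> space \<Omega>"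
      by (auto simp: S_def)
    show ?thesis
      unfolding LN.tail_eq_cdf[symmetric] unfolding conv[symmetric] eq
      by (rule measure_distr[symmetric]) measurable
  qed
  have lim_sum: "((\<lambda>u. prob {\<omega> \<in> space \<Omega>. M 0 \<omega> + M 1 \<omega> + Ce 1 \<omega> > u} / h u) \<longlongrightarrow> 1) at_top"
    using convolution_light_long_tailed[OF L N L0 _ intL] \<gamma> pos long
    unfolding tail_sum cdfN h_def by simp

  \<comment> \<open>The maxima of heavy claims\<close>
  have lim_max: "((\<lambda>u. prob {\<omega> \<in> space \<Omega>. Max ((\<lambda>i. Ce i \<omega>) ` {1..k}) > u} / h u) \<longlongrightarrow> real k) at_top"
    if k: "2 \<le> k" for k
  proof -
    let ?I = "Inr ` {1..k} :: (nat + nat) set"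
    have "indep_vars (\<lambda>_. borel) (case_sum M Ce) ?I"
      by (rule indep_vars_subset[OF indep]) auto
    moreover have "cdf (distr \<Omega> borel (case_sum M Ce i)) = F" if "i \<in> ?I" for i
      using that Ce by (auto simp: F_def)
    ultimately have "prob {\<omega> \<in> space \<Omega>. Max ((\<lambda>i. Ce i \<omega>) ` {1..k}) > u} = 1 - F u ^ k" for u
      using prob_Max_greater[of "case_sum M Ce" ?I F] k by (simp add: image_image card_image)
    then show ?thesis unfolding h_def using one_minus_power_tendsto[OF lim1] pos by (simp add: h_def)
  qed

  \<comment> \<open>Assembling the limit and its closed form\<close>
  have "((\<lambda>u. (1 - q) * (ruin_prob R T U u / h u)
      + (1 - q) * q * (prob {\<omega> \<in> space \<Omega>. M 0 \<omega> + M 1 \<omega> + Ce 1 \<omega> > u} / h u)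
      + (1 - q) * (\<Sum>k=2..n. q ^ k *
          (prob {\<omega> \<in> space \<Omega>. Max ((\<lambda>i. Ce i \<omega>) ` {1..k}) > u} / h u)))
      \<longlongrightarrow> (1 - q) * 0 + (1 - q) * q * 1 + (1 - q) * (\<Sum>k=2..n. q ^ k * real k)) at_top"
    by (intro tendsto_intros lim_ruin lim_sum lim_max) auto
  moreover have "\<psi> u / h u = (1 - q) * (ruin_prob R T U u / h u)
      + (1 - q) * q * (prob {\<omega> \<in> space \<Omega>. M 0 \<omega> + M 1 \<omega> + Ce 1 \<omega> > u} / h u)
      + (1 - q) * (\<Sum>k=2..n. q ^ k *
          (prob {\<omega> \<in> space \<Omega>. Max ((\<lambda>i. Ce i \<omega>) ` {1..k}) > u} / h u))" for u
    unfolding \<psi> \<phi> q1 q_def[symmetric]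
    by (simp add: add_divide_distrib sum_divide_distrib[symmetric])
  \<comment> \<open>The term for \<open>k = 1\<close> is supplied by
    \<open>M 0 + M 1 + Ce 1\<close>, whose tail ratio has limit 1.\<close>
  moreover have "(\<Sum>k=1..n. real k * q ^ k) = q + (\<Sum>k=2..n. q ^ k * real k)"
    using n sum.atLeast_Suc_atMost[of 1 n "\<lambda>k. real k * q ^ k"]
    by (simp add: numeral_2_eq_2 mult.commute)
  ultimately have lim: "((\<lambda>u. \<psi> u / h u) \<longlongrightarrow> (1 - q) * (\<Sum>k=1..n. real k * q ^ k)) at_top"
    by (simp add: distrib_left)
  define c where "c = \<epsilon> * \<theta> / (1 - \<rho>) * (1 - (real n + 1) * q ^ n + real n * q ^ (n + 1))"
  have coeff: "\<epsilon> * \<theta> / (1 - \<rho>) = q / (1 - q)"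
    using \<rho>b1 net_profit unfolding q1[symmetric] by (simp add: q_def)
  have "c = (1 - q)\<^sup>2 * (\<Sum>k=1..n. real k * q ^ k) / (1 - q)"
    unfolding c_def coeff sum_index_times_power by simp
  then have c: "c = (1 - q) * (\<Sum>k=1..n. real k * q ^ k)"
    using q by (simp add: power2_eq_square)
  \<comment> \<open>A nonzero limit is what allows dividing by \<open>c\<close> and passing from the
    ratio to asymptotic equivalence; \<open>n \<ge> 1\<close> makes the sum nonempty.\<close>
  have "0 < (\<Sum>k=1..n. real k * q ^ k)" using n q by (intro sum_pos) auto
  then have "0 < c" using q by (simp add: c)
  have "((\<lambda>u. \<psi> u / (c * h u)) \<longlongrightarrow> 1) at_top"
    using tendsto_divide[OF lim[folded c] tendsto_const[of c]] \<open>0 < c\<close>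
    by (simp add: mult.commute)
  then have "\<psi> \<sim>[at_top] (\<lambda>u. c * h u)" by (rule asymp_equivI')
  then show ?thesis by (simp only: c_def q_def h_def F_def)
qed

end
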